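(* Let $n\ge1$, $a\in\mathbb{R}^n$, $\beta\in(0,1)$ and $q=1+\frac1{n+\beta}$. Let $\varepsilon>0$ be as in the following existence result: for each $w_0\in\mathcal{B}_1^{-\beta,\infty}$ with $\|w_0\|_{\mathcal{B}_1^{-\beta,\infty}}<\varepsilon$ there exists a solution $w\in\mathcal{X}$, for all $t\ge0$, of $$w_t-\Delta w+a\cdot\nabla(w|w|^{q-1})=0,\qquad w(\cdot,0)=w_0,$$ and it is the unique solution satisfying $\sup_{t>0}t^{(n/2)(1-1/q)+\beta/2}\|w(t)\|_q\le2\varepsilon$. Assume that $u_0\in\mathcal{B}_1^{-\beta,\infty}$, with $\|u_0\|_{\mathcal{B}_1^{-\beta,\infty}}<\varepsilon$, is a homogeneous distribution of degree $-n-\beta$. Then the so constructed solution $u$ with initial datum $u_0$ is self-similar; hence, of the form $$u(x,t)=t^{-\frac{n+\beta}2}\,U\!\left(\frac{x}{\sqrt t}\right),\qquad x\in\mathbb{R}^n,\ t>0,$$ where $U(x)=u(x,1)$.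
   Context: $\|\cdot\|_p$ is the norm of $L^p(\mathbb{R}^n)$; $e^{t\Delta}v=G(\cdot,t)*v$ with $G(x,t)=(4\pi t)^{-n/2}\exp(-|x|^2/(4t))$, for tempered distributions $v$. The homogeneous Besov space is $\mathcal{B}_1^{-\beta,\infty}=\{v\in\mathcal{S}'(\mathbb{R}^n):\|v\|_{\mathcal{B}_1^{-\beta,\infty}}<\infty\}$ with norm $\|v\|_{\mathcal{B}_1^{-\beta,\infty}}=\sup_{s>0}s^{\beta/2}\|e^{s\Delta}v\|_1$. $\mathcal{X}=\mathcal{C}([0,\infty):\mathcal{B}_1^{-\beta,\infty})\cap\{u:(0,\infty)\to L^q(\mathbb{R}^n):\sup_{t>0}t^{(n/2)(1-1/q)+\beta/2}\|u(t)\|_q<\infty\}$, where $\mathcal{C}([0,\infty):\mathcal{B}_1^{-\beta,\infty})$ is the space of continuous functions on $[0,\infty)$ with values in $\mathcal{B}_1^{-\beta,\infty}$. A solution with initial datum $u_0$ is understood as a solution of the integral equation $u(t)=e^{t\Delta}u_0-\int_0^t a\cdot\nabla e^{(t-\tau)\Delta}(u|u|^{q-1})(\tau)\,d\tau$. A tempered distribution $u_0$ is homogeneous of degree $d$ if $u_0(\lambda\,\cdot)=\lambda^{d}u_0$ for all $\lambda>0$. *)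

theory Defs
  imports "HOL-Analysis.Analysis"
begin

subsection \<open>Schwartz functions and tempered distributions\<close>

primrec iter_partial :: "'n list \<Rightarrow> (real^'n::finite \<Rightarrow> real) \<Rightarrow> real^'n \<Rightarrow> real" where
  "iter_partial [] f = f"
| "iter_partial (i # is) f = (\<lambda>x. frechet_derivative (iter_partial is f) (at x) (axis i 1))"

definition schwartz :: "(real^'n::finite \<Rightarrow> real) set" where
  "schwartz = {\<phi>. \<forall>is. (\<forall>x. iter_partial is \<phi> differentiable (at x)) \<and>
     (\<forall>k::nat. bounded (range (\<lambda>x. (1 + norm x) ^ k * iter_partial is \<phi> x)))}"

definition schwartz_norm :: "nat \<Rightarrow> (real^'n::finite \<Rightarrow> real) \<Rightarrow> real" where
  "schwartz_norm N \<phi> =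
     (\<Sum>is | length is \<le> N. SUP x. (1 + norm x) ^ N * \<bar>iter_partial is \<phi> x\<bar>)"

type_synonym 'n functional = "(real^'n \<Rightarrow> real) \<Rightarrow> real"

text \<open>Functionals are set to \<open>0\<close> off the Schwartz space, so that equality of tempered
  distributions is equality in HOL.\<close>

definition tempered :: "'n::finite functional set" where
  "tempered = {v.
     (\<forall>\<phi>\<in>schwartz. \<forall>\<psi>\<in>schwartz. \<forall>c. v (\<lambda>x. c * \<phi> x + \<psi> x) = c * v \<phi> + v \<psi>) \<and>
     (\<exists>C N. \<forall>\<phi>\<in>schwartz. \<bar>v \<phi>\<bar> \<le> C * schwartz_norm N \<phi>) \<and>
     (\<forall>\<phi>. \<phi> \<notin> schwartz \<longrightarrow> v \<phi> = 0)}"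

definition regular :: "(real^'n::finite \<Rightarrow> real) \<Rightarrow> 'n functional" where
  "regular f \<phi> = (if \<phi> \<in> schwartz then \<integral>x. f x * \<phi> x \<partial>lborel else 0)"

text \<open>The distribution \<open>v(r \<cdot>)\<close>, for \<open>r > 0\<close>.\<close>

definition dilate :: "real \<Rightarrow> 'n::finite functional \<Rightarrow> 'n functional" where
  "dilate r v \<phi> = v (\<lambda>x. \<phi> (x /\<^sub>R r)) / r ^ CARD('n)"

definition homogeneous :: "real \<Rightarrow> 'n::finite functional \<Rightarrow> bool" where
  "homogeneous d v \<longleftrightarrow> (\<forall>r>0. dilate r v = (\<lambda>\<phi>. r powr d * v \<phi>))"

subsection \<open>Lebesgue spaces\<close>

definition Lp_norm :: "real \<Rightarrow> (real^'n::finite \<Rightarrow> real) \<Rightarrow> ennreal" where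
  "Lp_norm p f = (let I = \<integral>\<^sup>+x. ennreal (\<bar>f x\<bar> powr p) \<partial>lborel
                  in if I = \<infinity> then \<infinity> else ennreal (enn2real I powr (1 / p)))"

definition Lp_space :: "real \<Rightarrow> (real^'n::finite \<Rightarrow> real) set" where
  "Lp_space p = {f \<in> borel_measurable lborel. Lp_norm p f < \<infinity>}"

text \<open>\<open>L\<^sup>p\<close> as a subspace of the tempered distributions. The representative
  \<open>Lp_rep p v\<close> of a distribution in \<open>L\<^sup>p\<close> is determined up to a null set.\<close>

definition Lp_distr :: "real \<Rightarrow> 'n::finite functional set" where
  "Lp_distr p = regular ` Lp_space p"

definition Lp_rep :: "real \<Rightarrow> 'n::finite functional \<Rightarrow> real^'n \<Rightarrow> real" where
  "Lp_rep p v = (SOME f. f \<in> Lp_space p \<and> v = regular f)"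

subsection \<open>Heat semigroup and Besov space\<close>

definition heat_kernel :: "real \<Rightarrow> real^'n::finite \<Rightarrow> real" where
  "heat_kernel t x = (4 * pi * t) powr (- real CARD('n) / 2) * exp (- (norm x)\<^sup>2 / (4 * t))"

text \<open>For \<open>t > 0\<close>, the smooth function \<open>G(\<cdot>, t) * v\<close>.\<close>

definition heat :: "real \<Rightarrow> 'n::finite functional \<Rightarrow> real^'n \<Rightarrow> real" where
  "heat t v x = v (\<lambda>y. heat_kernel t (x - y))"

definition besov_norm :: "real \<Rightarrow> 'n::finite functional \<Rightarrow> ennreal" where
  "besov_norm \<beta> v = (SUP s\<in>{0<..}. ennreal (s powr (\<beta> / 2)) * Lp_norm 1 (heat s v))"

definition besov :: "real \<Rightarrow> 'n::finite functional set" where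
  "besov \<beta> = {v \<in> tempered. besov_norm \<beta> v < \<infinity>}"

text \<open>Two topologies on the Besov space: that of its norm, and that of convergence in the sense
  of tempered distributions. The latter matters because the Besov norm is invariant under the
  scaling \<open>r powr (n + \<beta>) * v(r \<cdot>)\<close>: for a self-similar \<open>u\<close> with homogeneous datum,
  \<open>u t - u 0\<close> has the same norm for all \<open>t > 0\<close>, so that \<open>u\<close> is continuous at \<open>0\<close> for the norm
  only if it is constant.\<close>

datatype besov_topology = Norm_Topology | Distribution_Topology

fun continuous_path :: "besov_topology \<Rightarrow> real \<Rightarrow> (real \<Rightarrow> 'n::finite functional) \<Rightarrow> bool" where
  "continuous_path Norm_Topology \<beta> u \<longleftrightarrow>
     (\<forall>t\<ge>0. ((\<lambda>s. besov_norm \<beta> (u s - u t)) \<longlongrightarrow> 0) (at t within {0..}))"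
| "continuous_path Distribution_Topology \<beta> u \<longleftrightarrow>
     (\<forall>\<phi>\<in>schwartz. continuous_on {0..} (\<lambda>t. u t \<phi>))"

definition besov_paths :: "besov_topology \<Rightarrow> real \<Rightarrow> (real \<Rightarrow> 'n::finite functional) set" where
  "besov_paths T \<beta> = {u. (\<forall>t\<ge>0. u t \<in> besov \<beta>) \<and> continuous_path T \<beta> u}"

subsection \<open>Solutions\<close>

definition decay_norm :: "real \<Rightarrow> real \<Rightarrow> (real \<Rightarrow> 'n::finite functional) \<Rightarrow> ennreal" where
  "decay_norm \<beta> q u =
     (SUP t\<in>{0<..}. ennreal (t powr (real CARD('n) / 2 * (1 - 1 / q) + \<beta> / 2))
                     * Lp_norm q (Lp_rep q (u t)))"

definition X_space :: "besov_topology \<Rightarrow> real \<Rightarrow> real \<Rightarrow> (real \<Rightarrow> 'n::finite functional) set" where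
  "X_space T \<beta> q =
     besov_paths T \<beta> \<inter> {u. (\<forall>t>0. u t \<in> Lp_distr q) \<and> decay_norm \<beta> q u < \<infinity>}"

definition flux :: "real \<Rightarrow> 'n::finite functional \<Rightarrow> real^'n \<Rightarrow> real" where
  "flux q v x = Lp_rep q v x * \<bar>Lp_rep q v x\<bar> powr (q - 1)"

text \<open>The integrand \<open>a \<cdot> \<nabla> e\<^sup>(\<^sup>t\<^sup>-\<^sup>\<tau>\<^sup>)\<^sup>\<Delta> (u |u|\<^sup>q\<^sup>-\<^sup>1)(\<tau>)\<close> at the point \<open>x\<close>.\<close>

definition duhamel :: "real^'n::finite \<Rightarrow> real \<Rightarrow> (real \<Rightarrow> 'n functional) \<Rightarrow>
    real \<Rightarrow> real^'n \<Rightarrow> real \<Rightarrow> real" where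
  "duhamel a q u t x \<tau> = frechet_derivative (heat (t - \<tau>) (regular (flux q (u \<tau>)))) (at x) a"

text \<open>The integral equation, as an identity of functions for \<open>t > 0\<close>; at \<open>t = 0\<close> it reads
  \<open>u 0 = u0\<close>.\<close>

definition mild_solution :: "real^'n::finite \<Rightarrow> real \<Rightarrow> 'n functional \<Rightarrow>
    (real \<Rightarrow> 'n functional) \<Rightarrow> bool" where
  "mild_solution a q u0 u \<longleftrightarrow> u 0 = u0 \<and>
     (\<forall>t>0. AE x in lborel.
        set_integrable lborel {0<..<t} (duhamel a q u t x) \<and>
        Lp_rep q (u t) x = heat t u0 x - (LINT \<tau>:{0<..<t}|lborel. duhamel a q u t x \<tau>))"

text \<open>Invariance under \<open>u(x,t) \<mapsto> r powr k * u(r x, r\<^sup>2 t)\<close>.\<close>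

definition self_similar :: "real \<Rightarrow> (real \<Rightarrow> 'n::finite functional) \<Rightarrow> bool" where
  "self_similar k u \<longleftrightarrow>
     (\<forall>r>0. \<forall>t>0. u t = (\<lambda>\<phi>. r powr k * dilate r (u (r\<^sup>2 * t)) \<phi>))"

end

theory Submission
  imports Defs "HOL-Probability.Distributions"
begin

text \<open>Write \<open>k = n + \<beta>\<close>. Since \<open>k q = k + 1\<close>, the equation, the Besov norm and the decay norm are all
  invariant under \<open>u(x,t) \<mapsto> r\<^sup>k u(r x, r\<^sup>2 t)\<close>, and so is a datum homogeneous of degree \<open>-k\<close>. Hence
  the rescaled solution is a small solution with the same datum and equals \<open>u\<close> by uniqueness.

  Two points need analysis. The chosen representative \<open>Lp_rep\<close> is compatible with scaling only up to
  null sets, and only because a function in \<open>L\<^sup>p\<close> is determined by its integrals against Schwartz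
  functions. Moreover the junk value of \<open>frechet_derivative\<close> does not scale, so that
  \<open>e\<^sup>s\<^sup>\<Delta> F\<close> has to be shown differentiable for integrable \<open>F\<close>.\<close>

section \<open>Scaling of Lebesgue integrals\<close>

text \<open>The powers of \<open>r\<close> decide everything. With \<open>k = n + \<beta>\<close>,
  the exponent \<open>q = 1 + 1/k\<close> is the one for which the Duhamel term scales like the
  other terms: the flux contributes \<open>k * q\<close>, the derivative one more, and the
  substitution in time takes away 2, which leaves \<open>k\<close>. The Besov norm sees
  \<open>k - n = \<beta>\<close> and the decay norm \<open>k - n/q\<close>, in each case twice the
  exponent of its time weight. No smallness is lost, so uniqueness applies for either topology on
  the paths, and \<open>r = 1 / sqrt t\<close> in the resulting invariance gives the profile
  formula.

  The test functions are explicit because membership in \<open>schwartz\<close> is a condition on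
  every iterated \<open>frechet_derivative\<close>: for an algebra closed under differentiation this
  is an induction on the list of indices. The Gaussian factor supplies the decay, and it also makes
  every function in \<open>L^p\<close>, \<open>p \<ge> 1\<close>, integrable.\<close>

lemma AE_lborel_scaleR:
  fixes P :: "'a::euclidean_space \<Rightarrow> bool"
  assumes "AE x in lborel. P x" and r: "r > 0"
  shows "AE x in lborel. P (r *\<^sub>R x)"
proof -
  \<comment> \<open>Lebesgue measure is a positive constant times its image under scaling, so both
    have the same null sets.\<close>
  have L: "lborel = density (distr lborel borel (\<lambda>x::'a. 0 + r *\<^sub>R x)) (\<lambda>_. \<bar>r\<bar>^DIM('a))"
    using r by (intro lborel_affine) auto
  have "AE x in distr lborel borel (\<lambda>x::'a. 0 + r *\<^sub>R x). P x"
    using assms(1) r unfolding L[THEN arg_cong[where f=ae_filter]]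
    by (subst (asm) AE_density) auto
  then show ?thesis
    using AE_distrD[of "\<lambda>x. 0 + r *\<^sub>R x" lborel borel P] by simp
qed

lemma nn_integral_lborel_scaleR_measurable:
  fixes f :: "'a::euclidean_space \<Rightarrow> ennreal"
  assumes [measurable]: "f \<in> borel_measurable borel" and r: "r > 0"
  shows "(\<integral>\<^sup>+x. f x \<partial>lborel) = ennreal (r ^ DIM('a)) * (\<integral>\<^sup>+x. f (r *\<^sub>R x) \<partial>lborel)"
  using r
  by (subst lborel_affine[of r 0])
     (simp_all add: nn_integral_density nn_integral_distr nn_integral_cmult)

text \<open>No measurability is needed: scaling maps simple functions to simple functions. This spares
  proving that \<open>heat s v\<close> is measurable for an arbitrary functional \<open>v\<close>.\<close>

lemma nn_integral_lborel_scaleR: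
  fixes f :: "'a::euclidean_space \<Rightarrow> ennreal"
  assumes r: "r > 0"
  shows "(\<integral>\<^sup>+x. f x \<partial>lborel) = ennreal (r ^ DIM('a)) * (\<integral>\<^sup>+x. f (r *\<^sub>R x) \<partial>lborel)"
proof -
  have le: "(\<integral>\<^sup>+x. f x \<partial>lborel) \<le> ennreal (r ^ DIM('a)) * (\<integral>\<^sup>+x. f (r *\<^sub>R x) \<partial>lborel)"
    if r: "r > 0" for r and f :: "'a \<Rightarrow> ennreal"
    unfolding nn_integral_def[of _ f]
  proof (rule SUP_least, clarify)
    fix g :: "'a \<Rightarrow> ennreal" assume g: "simple_function lborel g" "g \<le> f"
    then have [measurable]: "g \<in> borel_measurable borel"
      by (auto dest: borel_measurable_simple_function)
    have "integral\<^sup>S lborel g = (\<integral>\<^sup>+x. g x \<partial>lborel)"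
      using g by (simp add: nn_integral_eq_simple_integral)
    also have "\<dots> = ennreal (r ^ DIM('a)) * (\<integral>\<^sup>+x. g (r *\<^sub>R x) \<partial>lborel)"
      using r by (intro nn_integral_lborel_scaleR_measurable) auto
    also have "\<dots> \<le> ennreal (r ^ DIM('a)) * (\<integral>\<^sup>+x. f (r *\<^sub>R x) \<partial>lborel)"
      using g(2) by (intro mult_left_mono nn_integral_mono) (auto simp: le_fun_def)
    finally show "integral\<^sup>S lborel g \<le> \<dots>" .
  qed
  \<comment> \<open>The reverse inequality is \<open>le\<close> for the factor \<open>1 / r\<close>
    and the scaled function.\<close>
  have "ennreal (r ^ DIM('a)) * (\<integral>\<^sup>+x. f (r *\<^sub>R x) \<partial>lborel)
      \<le> ennreal (r ^ DIM('a)) * (ennreal ((1 / r) ^ DIM('a)) *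
           (\<integral>\<^sup>+x. f (r *\<^sub>R ((1 / r) *\<^sub>R x)) \<partial>lborel))"
    using r by (intro mult_left_mono le) auto
  also have "\<dots> = (\<integral>\<^sup>+x. f x \<partial>lborel)"
    using r by (simp add: mult.assoc[symmetric] ennreal_mult[symmetric] power_one_over)
  finally show ?thesis
    using le[OF r, of f] by (rule antisym[rotated])
qed

lemma integrable_lborel_scaleR:
  fixes f :: "'a::euclidean_space \<Rightarrow> 'b::{banach, second_countable_topology}"
  assumes f: "integrable lborel f" and r: "r > 0"
  shows "integrable lborel (\<lambda>x. f (r *\<^sub>R x))"
proof -
  have [measurable]: "f \<in> borel_measurable borel"
    using f by auto
  show ?thesis
    using f r unfolding integrable_iff_bounded
    by (subst (asm) nn_integral_lborel_scaleR[OF r]) (auto simp: ennreal_mult_less_top)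
qed

lemma integral_lborel_scaleR:
  fixes f :: "'a::euclidean_space \<Rightarrow> real"
  assumes r: "r > 0"
  shows "(\<integral>x. f x \<partial>lborel) = r ^ DIM('a) * (\<integral>x. f (r *\<^sub>R x) \<partial>lborel)"
proof (cases "integrable lborel f")
  case True
  then have [measurable]: "f \<in> borel_measurable borel" by auto
  show ?thesis
    using r by (subst lborel_affine[of r 0])
      (simp_all add: integral_density integral_distr)
next
  case False
  \<comment> \<open>Scaling back by \<open>1 / r\<close> would make \<open>f\<close> integrable.
    Hence both integrals take the default value 0.\<close>
  moreover have "\<not> integrable lborel (\<lambda>x. f (r *\<^sub>R x))"
    using False integrable_lborel_scaleR[of "\<lambda>x. f (r *\<^sub>R x)" "1 / r"] r by auto
  ultimately show ?thesis
    by (simp add: not_integrable_integral_eq)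
qed

text \<open>Again free of measurability, for the sake of \<open>Lp_norm\<close> of
  \<open>heat s v\<close>. Simple functions below \<open>g\<close> give one inequality for every
  factor; applied to the factor \<open>1 / b\<close> and the integrand \<open>b * g\<close> it gives
  the other.\<close>

lemma nn_integral_cmult_pos:
  assumes b: "b > 0"
  shows "(\<integral>\<^sup>+x. ennreal b * g x \<partial>M) = ennreal b * (\<integral>\<^sup>+x. g x \<partial>M)"
proof -
  have le: "ennreal b * (\<integral>\<^sup>+x. g x \<partial>M) \<le> (\<integral>\<^sup>+x. ennreal b * g x \<partial>M)" for b g
    unfolding nn_integral_def[of _ g]
    unfolding SUP_mult_left_ennreal
  proof (rule SUP_least, clarify)
    fix h :: "'a \<Rightarrow> ennreal" assume h: "simple_function M h" "h \<le> g"
    have "ennreal b * integral\<^sup>S M h = (\<integral>\<^sup>+x. ennreal b * h x \<partial>M)"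
      using h by (simp add: nn_integral_eq_simple_integral[symmetric] nn_integral_cmult
          borel_measurable_simple_function)
    also have "\<dots> \<le> (\<integral>\<^sup>+x. ennreal b * g x \<partial>M)"
      using h(2) by (intro nn_integral_mono mult_left_mono) (auto simp: le_fun_def)
    finally show "ennreal b * integral\<^sup>S M h \<le> \<dots>" .
  qed
  have 1: "ennreal b * ennreal (1 / b) = 1" "ennreal (1 / b) * ennreal b = 1"
    using b by (simp_all add: ennreal_mult[symmetric])
  have "(\<integral>\<^sup>+x. ennreal b * g x \<partial>M) = ennreal b * (ennreal (1 / b) * (\<integral>\<^sup>+x. ennreal b * g x \<partial>M))"
    by (simp add: mult.assoc[symmetric] 1)
  also have "\<dots> \<le> ennreal b * (\<integral>\<^sup>+x. ennreal (1 / b) * (ennreal b * g x) \<partial>M)"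
    by (intro mult_left_mono le) auto
  also have "\<dots> = ennreal b * (\<integral>\<^sup>+x. g x \<partial>M)"
    by (simp add: mult.assoc[symmetric] 1)
  finally show ?thesis
    using le[of b g] by (rule antisym)
qed

lemma Lp_norm_scale:
  fixes f :: "real^'n::finite \<Rightarrow> real"
  assumes "r > 0" "c > 0" "p > 0"
  shows "Lp_norm p (\<lambda>x. c * f (r *\<^sub>R x))
       = ennreal (c * r powr (- real CARD('n) / p)) * Lp_norm p f"
proof -
  define I where "I = (\<integral>\<^sup>+x. ennreal (\<bar>f x\<bar> powr p) \<partial>lborel)"
  define J where "J = (\<integral>\<^sup>+x. ennreal (\<bar>f (r *\<^sub>R x)\<bar> powr p) \<partial>lborel)"
  have IJ: "I = ennreal (r ^ CARD('n)) * J"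
    unfolding I_def J_def
    using nn_integral_lborel_scaleR[OF \<open>r > 0\<close>, of "\<lambda>x::real^'n. ennreal (\<bar>f x\<bar> powr p)"]
    by simp
  have "ennreal (r powr (- real CARD('n))) * I = ennreal (r powr (- real CARD('n)) * r ^ CARD('n)) * J"
    unfolding IJ using assms by (simp add: mult.assoc[symmetric] ennreal_mult)
  also have "r powr (- real CARD('n)) * r ^ CARD('n) = 1"
    using assms by (simp add: powr_minus powr_realpow)
  finally have J: "J = ennreal (r powr (- real CARD('n))) * I" by simp
  define K where "K = (\<integral>\<^sup>+x. ennreal (\<bar>c * f (r *\<^sub>R x)\<bar> powr p) \<partial>lborel)"
  have "K = ennreal (c powr p) * J"
    unfolding K_def J_def using assms
    by (subst nn_integral_cmult_pos[symmetric]) (auto simp: abs_mult powr_mult ennreal_mult)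
  then have K: "K = ennreal (c powr p * r powr (- real CARD('n))) * I"
    unfolding J by (simp add: mult.assoc ennreal_mult)
  have pos: "c powr p * r powr (- real CARD('n)) > 0"
    using assms by simp
  show ?thesis
  proof (cases "I = \<infinity>")
    case True
    then have "K = \<infinity>" using K pos assms by (simp add: ennreal_mult_top)
    with True show ?thesis
      using assms by (simp add: Lp_norm_def K_def[symmetric] I_def[symmetric] ennreal_mult_top)
  next
    case False
    then have "K \<noteq> \<infinity>" using K by (simp add: ennreal_mult_eq_top_iff)
    have "enn2real K = c powr p * r powr (- real CARD('n)) * enn2real I"
      using K pos by (simp add: enn2real_mult)
    then have "enn2real K powr (1 / p) = c * r powr (- real CARD('n) / p) * enn2real I powr (1 / p)"
      using assms by (simp add: powr_mult powr_powr)
    with False \<open>K \<noteq> \<infinity>\<close> show ?thesis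
      using assms by (simp add: Lp_norm_def K_def[symmetric] I_def[symmetric] ennreal_mult)
  qed
qed

section \<open>Dilation of Schwartz functions and distributions\<close>

text \<open>The chain rule yields one factor \<open>c\<close> per derivative. It applies because all
  iterated derivatives of a Schwartz function are differentiable.\<close>

lemma iter_partial_scale:
  fixes \<phi> :: "real^'n::finite \<Rightarrow> real"
  assumes "\<phi> \<in> schwartz"
  shows "iter_partial is (\<lambda>x. \<phi> (c *\<^sub>R x)) = (\<lambda>x. c ^ length is * iter_partial is \<phi> (c *\<^sub>R x))"
proof (induction "is")
  case (Cons i "is")
  let ?g = "iter_partial is \<phi>"
  show ?case
  proof
    fix x
    have "(?g has_derivative frechet_derivative ?g (at (c *\<^sub>R x))) (at (c *\<^sub>R x))"
      using assms by (auto simp: schwartz_def frechet_derivative_works[symmetric])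
    moreover have "((\<lambda>x. c *\<^sub>R x) has_derivative (\<lambda>h. c *\<^sub>R h)) (at x)"
      by (auto intro!: derivative_eq_intros)
    ultimately have "((\<lambda>x. ?g (c *\<^sub>R x)) has_derivative
        (\<lambda>h. frechet_derivative ?g (at (c *\<^sub>R x)) (c *\<^sub>R h))) (at x)"
      by (rule has_derivative_compose[rotated])
    then have "((\<lambda>x. c ^ length is * ?g (c *\<^sub>R x)) has_derivative
        (\<lambda>h. c ^ length is * frechet_derivative ?g (at (c *\<^sub>R x)) (c *\<^sub>R h))) (at x)"
      by (rule has_derivative_mult_right)
    from frechet_derivative_at[OF this, symmetric]
    have "iter_partial (i # is) (\<lambda>x. \<phi> (c *\<^sub>R x)) x =
        c ^ length is * frechet_derivative ?g (at (c *\<^sub>R x)) (c *\<^sub>R axis i 1)"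
      by (simp add: Cons.IH)
    also have "frechet_derivative ?g (at (c *\<^sub>R x)) (c *\<^sub>R axis i 1)
        = c * frechet_derivative ?g (at (c *\<^sub>R x)) (axis i 1)"
      using assms
      by (subst linear_cmul[OF linear_frechet_derivative]) (auto simp: schwartz_def)
    finally show "iter_partial (i # is) (\<lambda>x. \<phi> (c *\<^sub>R x)) x =
        c ^ length (i # is) * iter_partial (i # is) \<phi> (c *\<^sub>R x)"
      by simp
  qed
qed simp

lemma iter_partial_bound:
  assumes "\<phi> \<in> schwartz"
  obtains B where "\<And>x. (1 + norm x) ^ k * \<bar>iter_partial is \<phi> x\<bar> \<le> B"
proof -
  have "bounded (range (\<lambda>x. (1 + norm x) ^ k * iter_partial is \<phi> x))"
    using assms by (auto simp: schwartz_def)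
  then obtain B where "\<And>x. norm ((1 + norm x) ^ k * iter_partial is \<phi> x) \<le> B"
    unfolding bounded_iff by auto
  then show ?thesis
    using that by (auto simp: abs_mult)
qed

lemma weight_scale_le:
  fixes x :: "'a::real_normed_vector"
  assumes c: "c > 0"
  shows "(1 + norm x) ^ k \<le> (1 + 1 / c) ^ k * (1 + norm (c *\<^sub>R x)) ^ k"
proof -
  have "1 + norm x \<le> (1 + 1 / c) * (1 + norm (c *\<^sub>R x))"
    using c by (simp add: field_simps)
  then have "(1 + norm x) ^ k \<le> ((1 + 1 / c) * (1 + norm (c *\<^sub>R x))) ^ k"
    by (intro power_mono) auto
  then show ?thesis by (simp add: power_mult_distrib)
qed

lemma schwartz_scale:
  fixes \<phi> :: "real^'n::finite \<Rightarrow> real"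
  assumes "\<phi> \<in> schwartz" and c: "c > 0"
  shows "(\<lambda>x. \<phi> (c *\<^sub>R x)) \<in> schwartz"
  unfolding schwartz_def mem_Collect_eq iter_partial_scale[OF assms(1)]
proof (intro allI conjI)
  fix "is" :: "'n list" and x :: "real^'n"
  have "iter_partial is \<phi> differentiable at (c *\<^sub>R x)"
    using assms by (auto simp: schwartz_def)
  then have "(iter_partial is \<phi> \<circ> (\<lambda>x. c *\<^sub>R x)) differentiable at x"
    by (intro differentiable_chain_at) auto
  then show "(\<lambda>x. c ^ length is * iter_partial is \<phi> (c *\<^sub>R x)) differentiable at x"
    by (auto simp: o_def)
next
  fix "is" :: "'n list" and k
  obtain B where B: "\<And>x. (1 + norm x) ^ k * \<bar>iter_partial is \<phi> x\<bar> \<le> B"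
    using iter_partial_bound[OF assms(1)] by metis
  have "norm ((1 + norm x) ^ k * (c ^ length is * iter_partial is \<phi> (c *\<^sub>R x)))
      \<le> (1 + 1 / c) ^ k * c ^ length is * B" for x
  proof -
    have "norm ((1 + norm x) ^ k * (c ^ length is * iter_partial is \<phi> (c *\<^sub>R x)))
        = (1 + norm x) ^ k * (c ^ length is * \<bar>iter_partial is \<phi> (c *\<^sub>R x)\<bar>)"
      using c by (simp add: abs_mult)
    also have "\<dots> \<le> (1 + 1 / c) ^ k * (1 + norm (c *\<^sub>R x)) ^ k *
        (c ^ length is * \<bar>iter_partial is \<phi> (c *\<^sub>R x)\<bar>)"
      using c by (intro mult_right_mono weight_scale_le) auto
    also have "\<dots> = (1 + 1 / c) ^ k * c ^ length is *
        ((1 + norm (c *\<^sub>R x)) ^ k * \<bar>iter_partial is \<phi> (c *\<^sub>R x)\<bar>)"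
      by (simp add: mult_ac)
    also have "\<dots> \<le> (1 + 1 / c) ^ k * c ^ length is * B"
      using c B[of "c *\<^sub>R x"] by (intro mult_left_mono) auto
    finally show ?thesis .
  qed
  then show "bounded (range (\<lambda>x. (1 + norm x) ^ k * (c ^ length is * iter_partial is \<phi> (c *\<^sub>R x))))"
    unfolding bounded_iff by auto
qed

lemma schwartz_scale_iff:
  fixes \<phi> :: "real^'n::finite \<Rightarrow> real"
  assumes "c > 0"
  shows "(\<lambda>x. \<phi> (c *\<^sub>R x)) \<in> schwartz \<longleftrightarrow> \<phi> \<in> schwartz"
  using schwartz_scale[of \<phi> c] schwartz_scale[of "\<lambda>x. \<phi> (c *\<^sub>R x)" "1 / c"] assms by auto

text \<open>The factor \<open>1 + 1 / c\<close> pays for moving the weight from \<open>x\<close> to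
  \<open>c *\<^sub>R x\<close>; the factor \<open>1 + c\<close> bounds the powers
  \<open>c ^ length is\<close> for all orders up to \<open>N\<close> at once, whether
  \<open>c\<close> is below or above 1.\<close>

lemma schwartz_norm_scale_le:
  fixes \<phi> :: "real^'n::finite \<Rightarrow> real"
  assumes \<phi>: "\<phi> \<in> schwartz" and c: "c > 0"
  shows "schwartz_norm N (\<lambda>x. \<phi> (c *\<^sub>R x)) \<le> ((1 + 1 / c) * (1 + c)) ^ N * schwartz_norm N \<phi>"
  unfolding schwartz_norm_def iter_partial_scale[OF \<phi>] sum_distrib_left
proof (rule sum_mono, rule cSUP_least)
  fix "is" :: "'n list" and x :: "real^'n"
  assume "is \<in> {is. length is \<le> N}"
  then have len: "length is \<le> N" by simp
  let ?g = "iter_partial is \<phi>"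
  obtain B where B: "\<And>x. (1 + norm x) ^ N * \<bar>?g x\<bar> \<le> B"
    using iter_partial_bound[OF \<phi>] by metis
  have sup: "(1 + norm (c *\<^sub>R x)) ^ N * \<bar>?g (c *\<^sub>R x)\<bar> \<le> (SUP x. (1 + norm x) ^ N * \<bar>?g x\<bar>)"
    using B by (intro cSUP_upper bdd_aboveI2) auto
  have "c ^ length is \<le> (1 + c) ^ length is"
    using c by (intro power_mono) auto
  also have "\<dots> \<le> (1 + c) ^ N"
    using c len by (intro power_increasing) auto
  finally have cN: "c ^ length is \<le> (1 + c) ^ N" .
  have "(1 + norm x) ^ N * \<bar>c ^ length is * ?g (c *\<^sub>R x)\<bar>
      = (1 + norm x) ^ N * (c ^ length is * \<bar>?g (c *\<^sub>R x)\<bar>)"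
    using c by (simp add: abs_mult)
  also have "\<dots> \<le> ((1 + 1 / c) ^ N * (1 + norm (c *\<^sub>R x)) ^ N) * ((1 + c) ^ N * \<bar>?g (c *\<^sub>R x)\<bar>)"
    using c by (intro mult_mono weight_scale_le cN) auto
  also have "\<dots> = ((1 + 1 / c) * (1 + c)) ^ N * ((1 + norm (c *\<^sub>R x)) ^ N * \<bar>?g (c *\<^sub>R x)\<bar>)"
    by (simp only: power_mult_distrib mult_ac)
  also have "\<dots> \<le> ((1 + 1 / c) * (1 + c)) ^ N * (SUP x. (1 + norm x) ^ N * \<bar>?g x\<bar>)"
    using c by (intro mult_left_mono sup) auto
  finally show "(1 + norm x) ^ N * \<bar>c ^ length is * ?g (c *\<^sub>R x)\<bar> \<le> \<dots>" .
qed auto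

text \<open>The spatial half of the parabolic scaling; the change of time is made in the argument,
  so that \<open>self_similar k u\<close> reads
  \<open>u t = rescale k r (u (r\<^sup>2 * t))\<close>.\<close>

definition rescale :: "real \<Rightarrow> real \<Rightarrow> 'n::finite functional \<Rightarrow> 'n functional" where
  "rescale k r v = (\<lambda>\<phi>. r powr k * dilate r v \<phi>)"

lemma tempered_rescale:
  fixes v :: "'n::finite functional"
  assumes v: "v \<in> tempered" and r: "r > 0"
  shows "rescale k r v \<in> tempered"
proof -
  have lin: "v (\<lambda>x. c * \<phi> x + \<psi> x) = c * v \<phi> + v \<psi>"
    if "\<phi> \<in> schwartz" "\<psi> \<in> schwartz" for c \<phi> \<psi>
    using v that by (auto simp: tempered_def)
  have zero: "v \<phi> = 0" if "\<phi> \<notin> schwartz" for \<phi>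
    using v that by (auto simp: tempered_def)
  obtain C N where CN: "\<And>\<phi>. \<phi> \<in> schwartz \<Longrightarrow> \<bar>v \<phi>\<bar> \<le> C * schwartz_norm N \<phi>"
    using v unfolding tempered_def by blast
  let ?A = "r powr k / r ^ CARD('n)"
  let ?M = "((1 + 1 / inverse r) * (1 + inverse r)) ^ N"
  have "\<bar>rescale k r v \<phi>\<bar> \<le> (?A * \<bar>C\<bar> * ?M) * schwartz_norm N \<phi>" if \<phi>: "\<phi> \<in> schwartz" for \<phi>
  proof -
    let ?\<psi> = "\<lambda>x. \<phi> (x /\<^sub>R r)"
    have \<psi>: "?\<psi> \<in> schwartz" using schwartz_scale[OF \<phi>, of "inverse r"] r by simp
    \<comment> \<open>The constant \<open>C\<close> may be negative. Passing to its absolute value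
      needs a nonnegative seminorm, hence suprema over sets that are bounded above.\<close>
    have nn: "schwartz_norm N ?\<psi> \<ge> 0"
      unfolding schwartz_norm_def
    proof (rule sum_nonneg)
      fix "is"
      obtain B where B: "\<And>x. (1 + norm x) ^ N * \<bar>iter_partial is ?\<psi> x\<bar> \<le> B"
        using iter_partial_bound[OF \<psi>] by metis
      have "0 \<le> (1 + norm (0::real^'n)) ^ N * \<bar>iter_partial is ?\<psi> 0\<bar>" by simp
      also have "\<dots> \<le> (SUP x. (1 + norm x) ^ N * \<bar>iter_partial is ?\<psi> x\<bar>)"
        using B by (intro cSUP_upper bdd_aboveI2) auto
      finally show "0 \<le> (SUP x. (1 + norm x) ^ N * \<bar>iter_partial is ?\<psi> x\<bar>)" .
    qed
    have "\<bar>v ?\<psi>\<bar> \<le> C * schwartz_norm N ?\<psi>"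
      using CN[OF \<psi>] .
    also have "\<dots> \<le> \<bar>C\<bar> * schwartz_norm N ?\<psi>"
      using nn by (intro mult_right_mono) auto
    also have "\<dots> \<le> \<bar>C\<bar> * (?M * schwartz_norm N \<phi>)"
      using schwartz_norm_scale_le[OF \<phi>, of "inverse r" N] r by (intro mult_left_mono) auto
    finally have "?A * \<bar>v ?\<psi>\<bar> \<le> ?A * (\<bar>C\<bar> * (?M * schwartz_norm N \<phi>))"
      using r by (intro mult_left_mono) auto
    moreover have "\<bar>rescale k r v \<phi>\<bar> = ?A * \<bar>v ?\<psi>\<bar>"
      using r by (simp add: rescale_def dilate_def abs_mult)
    ultimately show ?thesis by (simp add: mult_ac)
  qed
  moreover have "rescale k r v (\<lambda>x. c * \<phi> x + \<psi> x) = c * rescale k r v \<phi> + rescale k r v \<psi>"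
    if "\<phi> \<in> schwartz" "\<psi> \<in> schwartz" for c \<phi> \<psi>
  proof -
    have "(\<lambda>x. \<phi> (x /\<^sub>R r)) \<in> schwartz" "(\<lambda>x. \<psi> (x /\<^sub>R r)) \<in> schwartz"
      using schwartz_scale[OF that(1), of "inverse r"] schwartz_scale[OF that(2), of "inverse r"] r
      by simp_all
    from lin[OF this, of c] show ?thesis
      using r by (simp add: rescale_def dilate_def field_simps)
  qed
  moreover have "rescale k r v \<phi> = 0" if "\<phi> \<notin> schwartz" for \<phi>
    using zero[of "\<lambda>x. \<phi> (x /\<^sub>R r)"] schwartz_scale_iff[of "inverse r" \<phi>] r that
    by (simp add: rescale_def dilate_def)
  ultimately show ?thesis
    unfolding tempered_def by blast
qed

lemma heat_kernel_scale:
  fixes z :: "real^'n::finite"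
  assumes "r > 0" "t > 0"
  shows "heat_kernel t (z /\<^sub>R r) = r ^ CARD('n) * heat_kernel (r\<^sup>2 * t) z"
proof -
  have "(4 * pi * (r\<^sup>2 * t)) powr (- real CARD('n) / 2)
      = (r\<^sup>2) powr (- real CARD('n) / 2) * (4 * pi * t) powr (- real CARD('n) / 2)"
    using assms by (subst powr_mult[symmetric]) (auto simp: mult_ac)
  also have "(r\<^sup>2) powr (- real CARD('n) / 2) = 1 / r ^ CARD('n)"
    using assms by (simp add: powr_powr powr_minus_divide powr_realpow flip: powr_numeral)
  finally have "r ^ CARD('n) * (4 * pi * (r\<^sup>2 * t)) powr (- real CARD('n) / 2)
      = (4 * pi * t) powr (- real CARD('n) / 2)"
    using assms by simp
  moreover have "(norm (z /\<^sub>R r))\<^sup>2 / (4 * t) = (norm z)\<^sup>2 / (4 * (r\<^sup>2 * t))"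
    using assms by (simp add: field_simps power_mult_distrib)
  ultimately show ?thesis
    by (simp add: heat_kernel_def mult.assoc[symmetric])
qed

section \<open>Schwartz functions separate \<open>L\<^sup>p\<close> functions\<close>

text \<open>These functions are closed under partial derivatives because \<open>tanh' = 1 - tanh\<^sup>2\<close>, so their
  products with a Gaussian are Schwartz functions; and \<open>tanh\<close> approximates the sign function.\<close>

inductive_set tanh_algebra :: "(real^'n::finite \<Rightarrow> real) set" where
  const: "(\<lambda>x. c) \<in> tanh_algebra"
| coord: "(\<lambda>x. x $ i) \<in> tanh_algebra"
| tanh: "(\<lambda>x. tanh (k * (x $ i - c))) \<in> tanh_algebra"
| add: "f \<in> tanh_algebra \<Longrightarrow> g \<in> tanh_algebra \<Longrightarrow> (\<lambda>x. f x + g x) \<in> tanh_algebra"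
| mult: "f \<in> tanh_algebra \<Longrightarrow> g \<in> tanh_algebra \<Longrightarrow> (\<lambda>x. f x * g x) \<in> tanh_algebra"

lemma tanh_algebra_prod:
  assumes "finite I" "\<And>i. i \<in> I \<Longrightarrow> f i \<in> tanh_algebra"
  shows "(\<lambda>x. \<Prod>i\<in>I. f i x) \<in> tanh_algebra"
  using assms by (induction I rule: finite_induct) (auto intro: tanh_algebra.intros)

lemma tanh_algebra_has_derivative:
  fixes f :: "real^'n::finite \<Rightarrow> real"
  assumes "f \<in> tanh_algebra"
  shows "\<exists>D. (\<forall>x. (f has_derivative D x) (at x)) \<and> (\<forall>i. (\<lambda>x. D x (axis i 1)) \<in> tanh_algebra)"
  using assms
proof induction
  case (const c)
  show ?case
    by (intro exI[of _ "\<lambda>x h. 0"]) (auto intro: tanh_algebra.intros)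
next
  case (coord i)
  show ?case
    by (intro exI[of _ "\<lambda>x h. h $ i"])
      (auto intro: tanh_algebra.intros bounded_linear_imp_has_derivative bounded_linear_vec_nth)
next
  case (tanh k i c)
  show ?case
  \<comment> \<open>The derivative \<open>1 - tanh\<^sup>2\<close> is spelled with sums and products
    only, so that the introduction rules of \<open>tanh_algebra\<close> match it.\<close>
  proof (intro exI[of _ "\<lambda>x h. (1 + (- 1) * (tanh (k * (x $ i - c)) * tanh (k * (x $ i - c)))) * (k * (h $ i))"]
      conjI allI)
    fix x :: "real^'n"
    have "((\<lambda>x. k * (x $ i - c)) has_derivative (\<lambda>h. k * (h $ i))) (at x)"
      by (auto intro!: derivative_eq_intros bounded_linear_imp_has_derivative bounded_linear_vec_nth)
    moreover have "((\<lambda>z. tanh z) has_field_derivative 1 - tanh z ^ 2) (at z)" for z :: real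
      by (auto intro!: derivative_eq_intros)
    then have "(tanh has_derivative (*) (1 - tanh (k * (x $ i - c)) ^ 2)) (at (k * (x $ i - c)))"
      by (simp add: has_field_derivative_def)
    ultimately show "((\<lambda>x. tanh (k * (x $ i - c))) has_derivative
        (\<lambda>h. (1 + (- 1) * (tanh (k * (x $ i - c)) * tanh (k * (x $ i - c)))) * (k * (h $ i)))) (at x)"
      by (auto dest: has_derivative_compose simp: power2_eq_square)
  next
    fix j
    show "(\<lambda>x. (1 + (- 1) * (tanh (k * (x $ i - c)) * tanh (k * (x $ i - c)))) *
        (k * (axis j 1 :: real^'n) $ i)) \<in> tanh_algebra"
      by (intro tanh_algebra.intros)
  qed
next
  case (add f g)
  then obtain D E where "\<forall>x. (f has_derivative D x) (at x)" "\<forall>i. (\<lambda>x. D x (axis i 1)) \<in> tanh_algebra"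
    "\<forall>x. (g has_derivative E x) (at x)" "\<forall>i. (\<lambda>x. E x (axis i 1)) \<in> tanh_algebra"
    by blast
  then show ?case
    by (intro exI[of _ "\<lambda>x h. D x h + E x h"]) (auto intro: tanh_algebra.intros has_derivative_add)
next
  case (mult f g)
  then obtain D E where "\<forall>x. (f has_derivative D x) (at x)" "\<forall>i. (\<lambda>x. D x (axis i 1)) \<in> tanh_algebra"
    "\<forall>x. (g has_derivative E x) (at x)" "\<forall>i. (\<lambda>x. E x (axis i 1)) \<in> tanh_algebra"
    by blast
  then show ?case
    using mult.hyps
    by (intro exI[of _ "\<lambda>x h. f x * E x h + D x h * g x"])
      (auto intro!: tanh_algebra.intros has_derivative_mult)
qed

text \<open>Polynomial growth is what a Gaussian factor can absorb, see
  \<open>weight_gauss_bound\<close>.\<close>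

lemma tanh_algebra_bound:
  fixes f :: "real^'n::finite \<Rightarrow> real"
  assumes "f \<in> tanh_algebra"
  shows "\<exists>C m. \<forall>x. \<bar>f x\<bar> \<le> C * (1 + norm x) ^ m"
  using assms
proof induction
  case (const c)
  show ?case by (rule exI[of _ "\<bar>c\<bar>"], rule exI[of _ 0]) auto
next
  case (coord i)
  have "\<bar>x $ i\<bar> \<le> 1 * (1 + norm x) ^ 1" for x :: "real^'n"
    using component_le_norm_cart[of x i] by simp
  then show ?case by blast
next
  case (tanh k i c)
  have "\<bar>tanh (k * (x $ i - c))\<bar> \<le> 1 * (1 + norm x) ^ 0" for x :: "real^'n"
    using tanh_real_bounds[of "k * (x $ i - c)"] by auto
  then show ?case by blast
next
  case (add f g)
  then obtain C m D l where fg: "\<And>x. \<bar>f x\<bar> \<le> C * (1 + norm x) ^ m" "\<And>x. \<bar>g x\<bar> \<le> D * (1 + norm x) ^ l"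
    by blast
  have "\<bar>f x + g x\<bar> \<le> (\<bar>C\<bar> + \<bar>D\<bar>) * (1 + norm x) ^ (m + l)" for x
  proof -
    have "\<bar>f x + g x\<bar> \<le> C * (1 + norm x) ^ m + D * (1 + norm x) ^ l"
      using fg[of x] by linarith
    also have "\<dots> \<le> \<bar>C\<bar> * (1 + norm x) ^ (m + l) + \<bar>D\<bar> * (1 + norm x) ^ (m + l)"
      by (intro add_mono mult_mono power_increasing) auto
    finally show ?thesis by (simp add: distrib_right)
  qed
  then show ?case by blast
next
  case (mult f g)
  then obtain C m D l where fg: "\<And>x. \<bar>f x\<bar> \<le> C * (1 + norm x) ^ m" "\<And>x. \<bar>g x\<bar> \<le> D * (1 + norm x) ^ l"
    by blast
  have "\<bar>f x * g x\<bar> \<le> (C * D) * (1 + norm x) ^ (m + l)" for x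
  proof -
    have "\<bar>f x * g x\<bar> \<le> (C * (1 + norm x) ^ m) * (D * (1 + norm x) ^ l)"
      unfolding abs_mult using fg[of x] by (intro mult_mono) (auto intro: order_trans[OF abs_ge_zero])
    then show ?thesis by (simp add: power_add mult_ac)
  qed
  then show ?case by blast
qed

text \<open>Centred at \<open>y\<close> and not normalised. The width stays free:
  \<open>c = 1 / (4 * t)\<close> gives the heat kernel up to a constant, \<open>c = 1\<close> the
  integrable weight.\<close>

definition gauss :: "real \<Rightarrow> real^'n::finite \<Rightarrow> real^'n \<Rightarrow> real" where
  "gauss c y x = exp (- c * (norm (x - y))\<^sup>2)"

lemma gauss_has_derivative:
  "(gauss c y has_derivative (\<lambda>h. - 2 * c * ((x - y) \<bullet> h) * gauss c y x)) (at x)"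
proof -
  have "((\<lambda>x. exp (- c * ((x - y) \<bullet> (x - y)))) has_derivative
      (\<lambda>h. - 2 * c * ((x - y) \<bullet> h) * exp (- c * ((x - y) \<bullet> (x - y))))) (at x)"
    by (auto intro!: derivative_eq_intros simp: algebra_simps inner_commute)
  then show ?thesis
    by (simp add: gauss_def[abs_def] power2_norm_eq_inner)
qed

lemma gauss_pos: "gauss c y x > 0"
  by (simp add: gauss_def)

text \<open>Each partial derivative of a Gaussian is the Gaussian times a polynomial of degree one,
  so the Gaussian factors out at every step and only the coefficient changes, within the
  algebra.\<close>

lemma iter_partial_tanh_gauss:
  fixes f :: "real^'n::finite \<Rightarrow> real"
  assumes "f \<in> tanh_algebra"
  shows "\<exists>g\<in>tanh_algebra. iter_partial is (\<lambda>x. f x * gauss c y x) = (\<lambda>x. g x * gauss c y x)"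
proof (induction "is")
  case Nil
  then show ?case using assms by auto
next
  case (Cons i "is")
  then obtain g where g: "g \<in> tanh_algebra"
    "iter_partial is (\<lambda>x. f x * gauss c y x) = (\<lambda>x. g x * gauss c y x)" by auto
  obtain D where D: "\<And>x. (g has_derivative D x) (at x)" "\<And>i. (\<lambda>x. D x (axis i 1)) \<in> tanh_algebra"
    using tanh_algebra_has_derivative[OF g(1)] by blast
  have "((\<lambda>x. g x * gauss c y x) has_derivative
      (\<lambda>h. g x * (- 2 * c * ((x - y) \<bullet> h) * gauss c y x) + D x h * gauss c y x)) (at x)" for x
    by (intro has_derivative_mult D gauss_has_derivative)
  note fd = frechet_derivative_at[OF this, symmetric]
  have "iter_partial (i # is) (\<lambda>x. f x * gauss c y x) =
      (\<lambda>x. (g x * ((- 2 * c) * (x $ i + (- y $ i))) + D x (axis i 1)) * gauss c y x)"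
    by (simp add: g(2) fd inner_axis) (simp add: algebra_simps)
  moreover have "(\<lambda>x. g x * ((- 2 * c) * (x $ i + (- y $ i))) + D x (axis i 1)) \<in> tanh_algebra"
    by (intro tanh_algebra.intros g D)
  ultimately show ?case by (rule bexI)
qed

text \<open>With \<open>s = norm (x - y)\<close>, the elementary estimate
  \<open>1 + s \<le> (2 + 1 / d) * exp (d * s\<^sup>2)\<close> is raised to the power
  \<open>m\<close>; the exponential it costs is cancelled by the Gaussian.\<close>

lemma weight_gauss_bound:
  fixes y :: "real^'n::finite"
  assumes c: "c > 0"
  shows "\<exists>B. \<forall>x. (1 + norm x) ^ m * gauss c y x \<le> B"
proof -
  \<comment> \<open>The power \<open>m\<close> turns \<open>d\<close> into \<open>m * d\<close>,
    which has to stay below \<open>c\<close>; the \<open>+ 1\<close> covers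
    \<open>m = 0\<close>.\<close>
  define d where "d = c / (real m + 1)"
  have d: "d > 0" "real m * d \<le> c"
    using c by (auto simp: d_def field_simps)
  have "(1 + norm x) ^ m * gauss c y x \<le> ((1 + norm y) * (2 + 1 / d)) ^ m" for x
  proof -
    define s where "s = norm (x - y)"
    have s0: "s \<ge> 0" by (simp add: s_def)
    have "1 + norm x \<le> 1 + (norm y + s)"
      unfolding s_def using norm_triangle_sub[of x y] by simp
    also have "\<dots> \<le> (1 + norm y) * (1 + s)"
      using s0 by (simp add: algebra_simps)
    also have "\<dots> \<le> (1 + norm y) * ((2 + 1 / d) * exp (d * s\<^sup>2))"
    proof (intro mult_left_mono)
      have "s \<le> 1 + s\<^sup>2"
        using sum_squares_ge_zero[of "s - 1" "s"] zero_le_power2[of "s - 1"] s0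
        by (simp add: power2_eq_square algebra_simps)
      moreover have "0 \<le> 1 / d + d * (2 * s\<^sup>2)"
        using d by simp
      moreover have "(2 + 1 / d) * (1 + d * s\<^sup>2) = 2 + s\<^sup>2 + (1 / d + d * (2 * s\<^sup>2))"
        using d by (simp add: algebra_simps)
      ultimately have "1 + s \<le> (2 + 1 / d) * (1 + d * s\<^sup>2)"
        by linarith
      also have "\<dots> \<le> (2 + 1 / d) * exp (d * s\<^sup>2)"
        using d by (intro mult_left_mono exp_ge_add_one_self) auto
      finally show "1 + s \<le> \<dots>" .
    qed auto
    finally have "(1 + norm x) ^ m \<le> ((1 + norm y) * ((2 + 1 / d) * exp (d * s\<^sup>2))) ^ m"
      by (intro power_mono) auto
    also have "\<dots> = ((1 + norm y) * (2 + 1 / d)) ^ m * exp (real m * d * s\<^sup>2)"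
      by (simp add: power_mult_distrib exp_of_nat_mult[symmetric] mult_ac)
    also have "\<dots> \<le> ((1 + norm y) * (2 + 1 / d)) ^ m * exp (c * s\<^sup>2)"
      using d by (intro mult_left_mono) (auto intro!: mult_right_mono)
    finally have "(1 + norm x) ^ m * gauss c y x \<le> ((1 + norm y) * (2 + 1 / d)) ^ m * exp (c * s\<^sup>2) * gauss c y x"
      using gauss_pos[of c y x] by (intro mult_right_mono) auto
    also have "\<dots> = ((1 + norm y) * (2 + 1 / d)) ^ m"
      by (simp add: gauss_def s_def mult.assoc exp_add[symmetric])
    finally show ?thesis .
  qed
  then show ?thesis by blast
qed

lemma tanh_gauss_schwartz:
  fixes f :: "real^'n::finite \<Rightarrow> real"
  assumes f: "f \<in> tanh_algebra" and c: "c > 0"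
  shows "(\<lambda>x. f x * gauss c y x) \<in> schwartz"
  unfolding schwartz_def
proof (intro CollectI allI conjI)
  fix "is" :: "'n list" and x :: "real^'n"
  obtain g where g: "g \<in> tanh_algebra"
    "iter_partial is (\<lambda>x. f x * gauss c y x) = (\<lambda>x. g x * gauss c y x)"
    using iter_partial_tanh_gauss[OF f] by blast
  obtain D where D: "\<And>x. (g has_derivative D x) (at x)"
    using tanh_algebra_has_derivative[OF g(1)] by blast
  show "iter_partial is (\<lambda>x. f x * gauss c y x) differentiable at x"
    unfolding g(2) differentiable_def
    by (blast intro: has_derivative_mult D gauss_has_derivative)
next
  fix "is" :: "'n list" and k
  obtain g where g: "g \<in> tanh_algebra"
    "iter_partial is (\<lambda>x. f x * gauss c y x) = (\<lambda>x. g x * gauss c y x)"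
    using iter_partial_tanh_gauss[OF f] by blast
  obtain C m where C: "\<And>x. \<bar>g x\<bar> \<le> C * (1 + norm x) ^ m"
    using tanh_algebra_bound[OF g(1)] by blast
  then have C0: "C \<ge> 0" using C[of 0] by auto
  obtain B where B: "\<And>x. (1 + norm x) ^ (k + m) * gauss c y x \<le> B"
    using weight_gauss_bound[OF c] by blast
  have "norm ((1 + norm x) ^ k * (g x * gauss c y x)) \<le> C * B" for x
  proof -
    have "norm ((1 + norm x) ^ k * (g x * gauss c y x)) = (1 + norm x) ^ k * (\<bar>g x\<bar> * gauss c y x)"
      using gauss_pos[of c y x] by (simp add: abs_mult)
    also have "\<dots> \<le> (1 + norm x) ^ k * ((C * (1 + norm x) ^ m) * gauss c y x)"
      using C[of x] gauss_pos[of c y x] by (intro mult_left_mono mult_right_mono) auto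
    also have "\<dots> = C * ((1 + norm x) ^ (k + m) * gauss c y x)"
      by (simp add: power_add mult_ac)
    also have "\<dots> \<le> C * B"
      using B C0 by (intro mult_left_mono) auto
    finally show ?thesis .
  qed
  then show "bounded (range (\<lambda>x. (1 + norm x) ^ k * iter_partial is (\<lambda>x. f x * gauss c y x) x))"
    unfolding g(2) bounded_iff by auto
qed

text \<open>The centre is \<open>x\<close> and the argument \<open>y\<close>: as a function of
  \<open>y\<close> the kernel is then an instance of \<open>tanh_gauss_schwartz\<close>.\<close>

lemma heat_kernel_eq_gauss:
  "heat_kernel t (x - y) = (4 * pi * t) powr (- real CARD('n::finite) / 2) * gauss (1 / (4 * t)) (x :: real^'n) y"
  by (simp add: heat_kernel_def gauss_def norm_minus_commute)

lemma heat_kernel_schwartz: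
  assumes "t > 0"
  shows "(\<lambda>y. heat_kernel t (x - y)) \<in> schwartz"
  unfolding heat_kernel_eq_gauss using assms
  by (intro tanh_gauss_schwartz tanh_algebra.intros) auto

section \<open>Integrability against weights\<close>

lemma Lp_space_measurable:
  "f \<in> Lp_space p \<Longrightarrow> f \<in> borel_measurable borel"
  by (simp add: Lp_space_def)

lemma Lp_space_integrable_powr:
  assumes "f \<in> Lp_space p"
  shows "integrable lborel (\<lambda>x. \<bar>f x\<bar> powr p)"
proof -
  have [measurable]: "f \<in> borel_measurable borel"
    using assms by (rule Lp_space_measurable)
  have "(\<integral>\<^sup>+x. ennreal (\<bar>f x\<bar> powr p) \<partial>lborel) < \<infinity>"
    using assms by (auto simp: Lp_space_def Lp_norm_def Let_def less_top split: if_splits)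
  then show ?thesis
    by (intro integrableI_bounded) auto
qed

text \<open>The product is dominated by \<open>\<bar>f x\<bar> powr p + \<bar>w x\<bar>\<close>: by
  the second summand where \<open>\<bar>f x\<bar> \<le> 1\<close>, by the first elsewhere.\<close>

lemma Lp_space_integrable_mult:
  assumes f: "f \<in> Lp_space p" and p: "p \<ge> 1"
    and w: "integrable lborel w" "\<And>x. \<bar>w x\<bar> \<le> 1"
  shows "integrable lborel (\<lambda>x. f x * w x)"
proof (rule Bochner_Integration.integrable_bound)
  show "integrable lborel (\<lambda>x. \<bar>f x\<bar> powr p + \<bar>w x\<bar>)"
    using Lp_space_integrable_powr[OF f] w by auto
  show "(\<lambda>x. f x * w x) \<in> borel_measurable lborel"
    using Lp_space_measurable[OF f] w by auto
  have "\<bar>f x * w x\<bar> \<le> \<bar>f x\<bar> powr p + \<bar>w x\<bar>" for x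
  proof (cases "\<bar>f x\<bar> \<le> 1")
    case True
    then have "\<bar>f x\<bar> * \<bar>w x\<bar> \<le> 1 * \<bar>w x\<bar>" by (intro mult_right_mono) auto
    then show ?thesis by (simp add: abs_mult add_increasing)
  next
    case False
    then have "\<bar>f x\<bar> powr 1 \<le> \<bar>f x\<bar> powr p" using p by (intro powr_mono) auto
    moreover have "\<bar>f x\<bar> * \<bar>w x\<bar> \<le> \<bar>f x\<bar> * 1" using w(2)[of x] by (intro mult_left_mono) auto
    ultimately show ?thesis using False by (simp add: abs_mult add_increasing2)
  qed
  then show "AE x in lborel. norm (f x * w x) \<le> norm (\<bar>f x\<bar> powr p + \<bar>w x\<bar>)"
    by (auto intro!: always_eventually order_trans[OF _ abs_ge_self])
qed

text \<open>The Gaussian is a product over the coordinates, which reduces the claim to dimension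
  one; there the half-line moment is doubled by evenness.\<close>

lemma gauss_integrable: "integrable lborel (gauss 1 (0::real^'n::finite))"
proof -
  have "has_bochner_integral lborel (\<lambda>x::real. exp (- x\<^sup>2)) (2 * (sqrt pi / 2))"
    using has_bochner_integral_even_function[OF gaussian_moment_0] by simp
  then have 1: "(\<integral>\<^sup>+x. ennreal (exp (- x\<^sup>2)) \<partial>(lborel :: real measure)) < \<infinity>"
    by (auto simp: has_bochner_integral_iff integrable_iff_bounded)
  have sq: "(norm x)\<^sup>2 = (\<Sum>b\<in>Basis. (x \<bullet> b)\<^sup>2)" for x :: "real^'n"
    unfolding power2_norm_eq_inner by (subst euclidean_inner) (simp add: power2_eq_square)
  have "ennreal (gauss 1 0 x) = (\<Prod>b\<in>Basis. ennreal (exp (- (x \<bullet> b)\<^sup>2)))" for x :: "real^'n"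
    by (simp add: gauss_def prod_ennreal sq exp_sum[symmetric] sum_negf)
  then have "(\<integral>\<^sup>+x. ennreal (gauss 1 (0::real^'n) x) \<partial>lborel)
      = (\<integral>\<^sup>+x. (\<Prod>b\<in>Basis. ennreal (exp (- ((x::real^'n) \<bullet> b)\<^sup>2))) \<partial>lborel)"
    by simp
  also have "\<dots> = (\<Prod>b\<in>(Basis :: (real^'n) set). \<integral>\<^sup>+x. ennreal (exp (- x\<^sup>2)) \<partial>lborel)"
    by (rule nn_integral_lborel_prod) auto
  also have "\<dots> < \<infinity>"
    using 1 by (simp add: power_less_top_ennreal)
  finally show ?thesis
    by (intro integrableI_bounded) (auto simp: gauss_def[abs_def])
qed

text \<open>The slope is \<open>m\<^sup>2\<close> rather than \<open>m\<close>: at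
  \<open>z = 0\<close> the argument of \<open>tanh\<close> is then \<open>- m\<close> and not the
  constant \<open>- 1\<close>.\<close>

definition soft_step :: "nat \<Rightarrow> real \<Rightarrow> real" where
  "soft_step m z = (1 + tanh ((real m)\<^sup>2 * (z - 1 / real m))) / 2"

lemma soft_step_bounds: "0 \<le> soft_step m z" "soft_step m z \<le> 1"
  using tanh_real_bounds[of "(real m)\<^sup>2 * (z - 1 / real m)"] by (auto simp: soft_step_def)

text \<open>The shift by \<open>1 / m\<close> makes the limit \<open>0\<close> also at \<open>z = 0\<close>.\<close>

lemma soft_step_tendsto: "(\<lambda>m. soft_step m z) \<longlonglongrightarrow> indicator {0<..} z"
proof (cases "z > 0")
  case True
  then have "filterlim (\<lambda>m. (real m)\<^sup>2 * (z - 1 / real m)) at_top sequentially"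
    by real_asymp
  from filterlim_compose[OF tanh_real_at_top this]
  have "(\<lambda>m. soft_step m z) \<longlonglongrightarrow> (1 + 1) / 2"
    unfolding soft_step_def by (intro tendsto_divide tendsto_add tendsto_const) auto
  with True show ?thesis by simp
next
  case False
  then consider "z < 0" | "z = 0" by linarith
  then have "filterlim (\<lambda>m. (real m)\<^sup>2 * (z - 1 / real m)) at_bot sequentially"
    by cases (real_asymp, simp, real_asymp)
  from filterlim_compose[OF tanh_real_at_bot this]
  have "(\<lambda>m. soft_step m z) \<longlonglongrightarrow> (1 + - 1) / 2"
    unfolding soft_step_def by (intro tendsto_divide tendsto_add tendsto_const) auto
  with False show ?thesis by simp
qed

definition soft_box :: "nat \<Rightarrow> real^'n::finite \<Rightarrow> real^'n \<Rightarrow> real^'n \<Rightarrow> real" where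
  "soft_box m a b x = (\<Prod>i\<in>UNIV. soft_step m (x $ i - a $ i) * soft_step m (b $ i - x $ i))"

lemma soft_box_in_tanh_algebra: "soft_box m a b \<in> tanh_algebra"
proof -
  \<comment> \<open>All factors are brought to the form \<open>tanh (k * (x $ i - c))\<close>. The
    upper faces need a negative slope, and there the shift by \<open>1 / m\<close> changes
    sign.\<close>
  have "soft_box m a b = (\<lambda>x. \<Prod>i\<in>UNIV.
      (1 / 2 * (1 + tanh ((real m)\<^sup>2 * (x $ i - (a $ i + 1 / real m))))) *
      (1 / 2 * (1 + tanh ((- (real m)\<^sup>2) * (x $ i - (b $ i - 1 / real m))))))"
  proof -
    have "soft_step m (z - u) = 1 / 2 * (1 + tanh ((real m)\<^sup>2 * (z - (u + 1 / real m))))"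
      "soft_step m (u - z) = 1 / 2 * (1 + tanh ((- (real m)\<^sup>2) * (z - (u - 1 / real m))))" for z u
      unfolding soft_step_def by (simp_all add: right_diff_distrib distrib_left)
    then show ?thesis by (simp only: soft_box_def[abs_def])
  qed
  also have "\<dots> \<in> tanh_algebra"
    by (intro tanh_algebra_prod tanh_algebra.intros) auto
  finally show ?thesis .
qed

lemma soft_box_bounds: "0 \<le> soft_box m a b x" "soft_box m a b x \<le> 1"
  unfolding soft_box_def
  by (auto intro!: prod_nonneg prod_le_1 mult_le_one soft_step_bounds mult_nonneg_nonneg)

lemma soft_box_tendsto: "(\<lambda>m. soft_box m a b x) \<longlonglongrightarrow> indicator (box a b) x"
proof -
  have "(\<lambda>m. soft_box m a b x) \<longlonglongrightarrow>
      (\<Prod>i\<in>UNIV. indicator {0<..} (x $ i - a $ i) * indicator {0<..} (b $ i - x $ i))"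
    unfolding soft_box_def by (intro tendsto_prod tendsto_mult soft_step_tendsto)
  also have "(\<Prod>i\<in>UNIV. indicator {0<..} (x $ i - a $ i) * indicator {0<..} (b $ i - x $ i))
      = (indicator (box a b) x :: real)"
    by (auto simp: indicator_def mem_box_cart prod_zero_iff)
  finally show ?thesis .
qed

lemma tanh_algebra_measurable:
  assumes "f \<in> tanh_algebra"
  shows "f \<in> borel_measurable borel"
  using tanh_algebra_has_derivative[OF assms]
  by (intro borel_measurable_continuous_onI)
    (auto simp: continuous_on_eq_continuous_at intro: has_derivative_continuous)

text \<open>Soft boxes converge boundedly to indicators of open boxes, so dominated convergence
  makes every box integral of \<open>F\<close> vanish. Boxes are stable under intersection and
  generate the Borel sets, which extends this to all Borel sets and identifies \<open>F\<close> with
  the zero density.\<close>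

lemma AE_zero_if_tanh_orthogonal:
  fixes F :: "real^'n::finite \<Rightarrow> real"
  assumes F: "integrable lborel F"
    and orth: "\<And>\<psi>. \<psi> \<in> tanh_algebra \<Longrightarrow> (\<And>x. \<bar>\<psi> x\<bar> \<le> 1) \<Longrightarrow> (\<integral>x. F x * \<psi> x \<partial>lborel) = 0"
  shows "AE x in lborel. F x = 0"
proof -
  have box: "(LINT x:box a b|lborel. F x) = 0" for a b :: "real^'n"
  proof -
    have "(\<lambda>m. \<integral>x. F x * soft_box m a b x \<partial>lborel) \<longlonglongrightarrow> (\<integral>x. F x * indicator (box a b) x \<partial>lborel)"
    proof (rule integral_dominated_convergence[where w="\<lambda>x. \<bar>F x\<bar>"])
      show "(\<lambda>x. F x * soft_box m a b x) \<in> borel_measurable lborel" for m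
        using F tanh_algebra_measurable[OF soft_box_in_tanh_algebra, of m a b] by auto
      show "AE x in lborel. norm (F x * soft_box m a b x) \<le> \<bar>F x\<bar>" for m
        using soft_box_bounds[of m a b]
        by (intro always_eventually) (auto simp: abs_mult intro!: mult_left_le)
    qed (use F in \<open>auto intro!: tendsto_mult soft_box_tendsto\<close>)
    moreover have "(\<integral>x. F x * soft_box m a b x \<partial>lborel) = 0" for m
      using soft_box_bounds[of m a b] by (intro orth soft_box_in_tanh_algebra) auto
    ultimately show ?thesis
      by (simp add: LIMSEQ_const_iff set_lebesgue_integral_def mult.commute)
  qed
  \<comment> \<open>The whole space is needed for complements in the induction below.\<close>
  have univ: "(\<integral>x. F x \<partial>lborel) = 0"
    using orth[OF tanh_algebra.const[of 1]] by simp
  have sets: "(LINT x:A|lborel. F x) = 0" if "A \<in> sets lborel" for A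
  proof -
    have "Int_stable (range (\<lambda>(a, b). box a b :: (real^'n) set))"
      by (auto simp: Int_stable_def box_Int_box)
    moreover have "range (\<lambda>(a, b). box a b :: (real^'n) set) \<subseteq> Pow UNIV"
      by simp
    moreover have "A \<in> sigma_sets UNIV (range (\<lambda>(a, b). box a b :: (real^'n) set))"
      using that by (simp add: borel_eq_box)
    ultimately show ?thesis
    proof (induction rule: sigma_sets_induct_disjoint)
      case (basic A)
      then show ?case using box by auto
    next
      case empty
      show ?case by (simp add: set_lebesgue_integral_def)
    next
      case (compl A)
      then have [measurable]: "A \<in> sets borel" by (simp add: borel_eq_box)
      have "(LINT x:A|lborel. F x) + (LINT x:UNIV - A|lborel. F x) = (LINT x:A \<union> (UNIV - A)|lborel. F x)"
        using F by (intro set_integral_Un[symmetric]) (auto simp: set_integrable_def integrable_real_mult_indicator mult.commute[of "indicator _ _"])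
      also have "\<dots> = 0"
        using univ by (simp add: set_lebesgue_integral_def)
      finally show ?case using compl by simp
    next
      case (union A)
      then have [measurable]: "A i \<in> sets borel" for i by (auto simp: borel_eq_box)
      have "(LINT x:(\<Union>i. A i)|lborel. F x) = (\<Sum>i. (LINT x:A i|lborel. F x))"
        using union F
        by (intro lebesgue_integral_countable_add)
          (auto simp: disjoint_family_on_def set_integrable_def integrable_real_mult_indicator
            mult.commute[of "indicator _ _"])
      then show ?case using union by simp
    qed
  qed
  show ?thesis
    using density_unique_real[OF F, of "\<lambda>_. 0"] sets by simp
qed

text \<open>The functions \<open>f\<close> and \<open>g\<close> need not be integrable, but their
  products with a Gaussian are. A bounded element of the algebra times this Gaussian is a Schwartz
  function, on which the two distributions agree, and the positive Gaussian is divided out at the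
  end.\<close>

lemma regular_inject_AE:
  fixes f g :: "real^'n::finite \<Rightarrow> real"
  assumes f: "f \<in> Lp_space p" and g: "g \<in> Lp_space p" and p: "p \<ge> 1" and eq: "regular f = regular g"
  shows "AE x in lborel. f x = g x"
proof -
  let ?E = "gauss 1 (0::real^'n)"
  have E1: "\<bar>?E x\<bar> \<le> 1" for x by (simp add: gauss_def)
  have int: "integrable lborel (\<lambda>x. f x * ?E x)" "integrable lborel (\<lambda>x. g x * ?E x)"
    using f g p gauss_integrable E1 by (auto intro: Lp_space_integrable_mult)
  have "AE x in lborel. f x * ?E x - g x * ?E x = 0"
  proof (rule AE_zero_if_tanh_orthogonal)
    show "integrable lborel (\<lambda>x. f x * ?E x - g x * ?E x)" using int by auto
    fix \<psi> :: "real^'n \<Rightarrow> real" assume \<psi>: "\<psi> \<in> tanh_algebra" "\<And>x. \<bar>\<psi> x\<bar> \<le> 1"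
    have w: "integrable lborel (\<lambda>x. \<psi> x * ?E x)"
      using borel_measurable_times[OF tanh_algebra_measurable[OF \<psi>(1)], of ?E]
        borel_measurable_integrable[OF gauss_integrable[where 'n='n]]
      by (intro Bochner_Integration.integrable_bound[OF gauss_integrable])
        (auto simp: abs_mult \<psi> intro!: always_eventually mult_left_le_one_le)
    have w1: "\<bar>\<psi> x * ?E x\<bar> \<le> 1" for x
      unfolding abs_mult using \<psi>(2) E1 by (intro mult_le_one) auto
    have "(\<integral>x. (f x * ?E x - g x * ?E x) * \<psi> x \<partial>lborel)
        = (\<integral>x. f x * (\<psi> x * ?E x) - g x * (\<psi> x * ?E x) \<partial>lborel)"
      by (simp add: algebra_simps)
    also have "\<dots> = (\<integral>x. f x * (\<psi> x * ?E x) \<partial>lborel) - (\<integral>x. g x * (\<psi> x * ?E x) \<partial>lborel)"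
      by (intro Bochner_Integration.integral_diff Lp_space_integrable_mult[OF _ p w w1] f g)
    also have "\<dots> = regular f (\<lambda>x. \<psi> x * ?E x) - regular g (\<lambda>x. \<psi> x * ?E x)"
      using tanh_gauss_schwartz[OF \<psi>(1), of 1 0] by (simp add: regular_def)
    also have "\<dots> = 0" by (simp add: eq)
    finally show "(\<integral>x. (f x * ?E x - g x * ?E x) * \<psi> x \<partial>lborel) = 0" .
  qed
  then show ?thesis
  proof eventually_elim
    case (elim x)
    then show ?case using gauss_pos[of 1 0 x] by simp
  qed
qed

section \<open>Differentiability of the heat semigroup\<close>

text \<open>Taylor expansion along the segment from \<open>x\<close> to \<open>x + h\<close>. The
  two parts of the second derivative are at most \<open>4 * c * (norm h)\<^sup>2\<close> and
  \<open>2 * c * (norm h)\<^sup>2\<close>, the first because \<open>z * exp (- z) \<le> 1\<close>;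
  halving the sum gives \<open>3 * c\<close>. The bound is uniform in \<open>y\<close>, so it can be
  integrated.\<close>

lemma gauss_second_order_bound:
  fixes x h y :: "real^'n::finite"
  assumes c: "c > 0"
  shows "\<bar>gauss c y (x + h) - gauss c y x - (- 2 * c * ((x - y) \<bullet> h) * gauss c y x)\<bar> \<le> 3 * c * (norm h)\<^sup>2"
proof -
  define w where "w s = x + s *\<^sub>R h - y" for s
  \<comment> \<open>For \<open>m = 0, 1, 2\<close> this is the \<open>m\<close>-th derivative of
    \<open>gauss\<close> along the segment.\<close>
  define D where "D m s = (if m = 0 then gauss c y (x + s *\<^sub>R h)
      else if m = 1 then - 2 * c * (w s \<bullet> h) * gauss c y (x + s *\<^sub>R h)
      else (- 2 * c * (h \<bullet> h) + (- 2 * c * (w s \<bullet> h)) * (- 2 * c * (w s \<bullet> h))) * gauss c y (x + s *\<^sub>R h))"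
    for m :: nat and s
  have d0: "((\<lambda>s. gauss c y (x + s *\<^sub>R h)) has_real_derivative
      (- 2 * c * (w s \<bullet> h) * gauss c y (x + s *\<^sub>R h))) (at s)" for s
  proof -
    have "((\<lambda>s. x + s *\<^sub>R h) has_derivative (\<lambda>d. d *\<^sub>R h)) (at s)"
      by (auto intro!: derivative_eq_intros)
    from has_derivative_compose[OF this gauss_has_derivative[of c y "x + s *\<^sub>R h"]] show ?thesis
      unfolding has_field_derivative_def
      by (rule has_derivative_eq_rhs) (simp add: w_def fun_eq_iff mult_ac)
  qed
  have d1: "((\<lambda>s. - 2 * c * (w s \<bullet> h)) has_real_derivative (- 2 * c * (h \<bullet> h))) (at s)" for s
    unfolding w_def by (auto intro!: derivative_eq_intros simp: inner_add_left inner_diff_left)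
  have "\<exists>t>0. t \<le> 1 \<and> gauss c y (x + 1 *\<^sub>R h) =
      (\<Sum>m<2. D m 0 / fact m * 1 ^ m) + D 2 t / fact 2 * 1 ^ 2"
  proof (rule Maclaurin2)
    show "\<forall>m t. m < 2 \<and> 0 \<le> t \<and> t \<le> 1 \<longrightarrow> (D m has_real_derivative D (Suc m) t) (at t)"
    proof (intro allI impI)
      fix m :: nat and t :: real assume "m < 2 \<and> 0 \<le> t \<and> t \<le> 1"
      then consider "m = 0" | "m = 1" by linarith
      then show "(D m has_real_derivative D (Suc m) t) (at t)"
      proof cases
        case 1
        then show ?thesis using d0[of t] by (simp add: D_def[abs_def])
      next
        case 2
        then show ?thesis using DERIV_mult[OF d1[of t] d0[of t]]
          by (simp add: D_def[abs_def] algebra_simps)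
      qed
    qed
  qed (auto simp: D_def)
  then obtain t where t: "gauss c y (x + h) = gauss c y x + D 1 0 + D 2 t / 2"
    by (auto simp: numeral_2_eq_2 D_def)
  have "\<bar>D 2 t\<bar> \<le> 6 * c * (norm h)\<^sup>2"
  proof -
    let ?g = "gauss c y (x + t *\<^sub>R h)"
    have g: "?g = exp (- (c * (norm (w t))\<^sup>2))" by (simp add: gauss_def w_def)
    have g1: "?g \<le> 1" using c by (simp add: g)
    have "c * (norm (w t))\<^sup>2 \<le> exp (c * (norm (w t))\<^sup>2)"
      using exp_ge_add_one_self[of "c * (norm (w t))\<^sup>2"] by linarith
    then have cw: "c * (norm (w t))\<^sup>2 * ?g \<le> 1"
      by (simp add: g exp_minus field_simps)
    have "(w t \<bullet> h)\<^sup>2 \<le> (norm (w t))\<^sup>2 * (norm h)\<^sup>2"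
      using Cauchy_Schwarz_ineq[of "w t" h] by (simp add: power2_norm_eq_inner)
    then have "4 * c\<^sup>2 * (w t \<bullet> h)\<^sup>2 * ?g \<le> 4 * c\<^sup>2 * ((norm (w t))\<^sup>2 * (norm h)\<^sup>2) * ?g"
      using gauss_pos[of c y "x + t *\<^sub>R h"] by (intro mult_right_mono mult_left_mono) auto
    also have "\<dots> = 4 * c * (norm h)\<^sup>2 * (c * (norm (w t))\<^sup>2 * ?g)"
      by (simp add: power2_eq_square mult_ac)
    also have "\<dots> \<le> 4 * c * (norm h)\<^sup>2 * 1"
      using c cw by (intro mult_left_mono) auto
    finally have 1: "4 * c\<^sup>2 * (w t \<bullet> h)\<^sup>2 * ?g \<le> 4 * c * (norm h)\<^sup>2" by simp
    have 2: "2 * c * (norm h)\<^sup>2 * ?g \<le> 2 * c * (norm h)\<^sup>2"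
      using c g1 by (intro mult_left_le) auto
    have 3: "0 \<le> 4 * c\<^sup>2 * (w t \<bullet> h)\<^sup>2 * ?g" "0 \<le> 2 * c * (norm h)\<^sup>2 * ?g" "0 \<le> 4 * c * (norm h)\<^sup>2"
      using c gauss_pos[of c y "x + t *\<^sub>R h"] by auto
    have "D 2 t = 4 * c\<^sup>2 * (w t \<bullet> h)\<^sup>2 * ?g - 2 * c * (norm h)\<^sup>2 * ?g"
      by (simp add: D_def power2_norm_eq_inner) (simp add: algebra_simps power2_eq_square)
    then show ?thesis using 1 2 3 by linarith
  qed
  moreover have "D 1 0 = - 2 * c * ((x - y) \<bullet> h) * gauss c y x"
    by (simp add: D_def w_def)
  ultimately show ?thesis
    using t by linarith
qed

text \<open>Integrating the second-order bound against \<open>\<bar>F y\<bar>\<close> leaves a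
  remainder of at most \<open>M * (norm (z - x))\<^sup>2\<close>, so the integral of the gradients
  is the derivative straight from the definition.\<close>

lemma gauss_integral_differentiable:
  fixes F :: "real^'n::finite \<Rightarrow> real"
  assumes F: "integrable lborel F" and c: "c > 0"
  shows "(\<lambda>x. \<integral>y. F y * gauss c y x \<partial>lborel) differentiable (at x)"
proof -
  have [measurable]: "F \<in> borel_measurable borel" using F by auto
  have [measurable]: "(\<lambda>y. gauss c y x) \<in> borel_measurable borel" for x :: "real^'n"
    unfolding gauss_def by measurable
  have g1: "gauss c y x \<le> 1" for x y :: "real^'n" using c by (simp add: gauss_def)
  have int: "integrable lborel (\<lambda>y. F y * gauss c y x)" for x
    using g1 gauss_pos[of c _ x]
    by (intro Bochner_Integration.integrable_bound[OF F])
      (auto simp: abs_mult abs_of_pos gauss_pos intro!: always_eventually mult_left_le)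
  \<comment> \<open>\<open>F y\<close> times the gradient in \<open>x\<close> of the Gaussian. Its
    integrability rests on \<open>ng\<close>, which follows from
    \<open>s \<le> 1 + s\<^sup>2\<close>.\<close>
  define V where "V y = (F y * (- 2 * c * gauss c y x)) *\<^sub>R (x - y)" for y
  have ng: "norm (x - y) * gauss c y x \<le> 1 + 1 / c" for y
  proof -
    let ?s = "norm (x - y)"
    have "c * ?s\<^sup>2 \<le> exp (c * ?s\<^sup>2)"
      using exp_ge_add_one_self[of "c * ?s\<^sup>2"] by linarith
    then have "c * (?s\<^sup>2 * gauss c y x) \<le> 1"
      by (simp add: gauss_def exp_minus field_simps)
    then have 1: "?s\<^sup>2 * gauss c y x \<le> 1 / c" using c by (simp add: field_simps)
    have "?s \<le> 1 + ?s\<^sup>2"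
    proof -
      have "2 * ?s \<le> ?s\<^sup>2 + 1"
        using zero_le_power2[of "?s - 1"] unfolding power2_diff by simp
      then show ?thesis using norm_ge_zero[of "x - y"] by linarith
    qed
    then have "?s * gauss c y x \<le> (1 + ?s\<^sup>2) * gauss c y x"
      using gauss_pos[of c y x] by (intro mult_right_mono) auto
    also have "\<dots> \<le> 1 + 1 / c"
      using 1 g1[of y x] by (simp add: distrib_right)
    finally show ?thesis .
  qed
  have V: "integrable lborel V"
  proof (rule Bochner_Integration.integrable_bound)
    show "integrable lborel (\<lambda>y. F y * (2 * c * (1 + 1 / c)))"
      using F by auto
    show "V \<in> borel_measurable lborel" unfolding V_def by measurable
    have "norm (V y) = (\<bar>F y\<bar> * (2 * c)) * (norm (x - y) * gauss c y x)" for y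
      using c gauss_pos[of c y x] by (simp add: V_def abs_mult)
    moreover have "(\<bar>F y\<bar> * (2 * c)) * (norm (x - y) * gauss c y x) \<le> (\<bar>F y\<bar> * (2 * c)) * (1 + 1 / c)" for y
      using c ng by (intro mult_left_mono) auto
    ultimately show "AE y in lborel. norm (V y) \<le> norm (F y * (2 * c * (1 + 1 / c)))"
      using c by (auto simp: abs_mult mult_ac)
  qed
  define L where "L h = (\<integral>y. V y \<partial>lborel) \<bullet> h" for h
  define I where "I x = (\<integral>y. F y * gauss c y x \<partial>lborel)" for x
  define M where "M = 3 * c * (\<integral>y. \<bar>F y\<bar> \<partial>lborel)"
  have bound: "\<bar>I z - I x - L (z - x)\<bar> \<le> M * (norm (z - x))\<^sup>2" for z
  proof -
    have "I z - I x - L (z - x) = (\<integral>y. F y * gauss c y z \<partial>lborel) - (\<integral>y. F y * gauss c y x \<partial>lborel)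
        - (\<integral>y. V y \<bullet> (z - x) \<partial>lborel)"
      using V by (simp add: I_def L_def)
    also have "\<dots> = (\<integral>y. F y * gauss c y z - F y * gauss c y x - V y \<bullet> (z - x) \<partial>lborel)"
      using int V by simp
    finally have "\<bar>I z - I x - L (z - x)\<bar> \<le> (\<integral>y. \<bar>F y\<bar> * (3 * c * (norm (z - x))\<^sup>2) \<partial>lborel)"
    proof (simp only:, intro integral_abs_bound_integral)
      fix y
      have "F y * gauss c y z - F y * gauss c y x - V y \<bullet> (z - x)
          = F y * (gauss c y (x + (z - x)) - gauss c y x - (- 2 * c * ((x - y) \<bullet> (z - x)) * gauss c y x))"
        by (simp add: V_def algebra_simps)
      also have "\<bar>\<dots>\<bar> \<le> \<bar>F y\<bar> * (3 * c * (norm (z - x))\<^sup>2)"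
        unfolding abs_mult[of "F y"] by (intro mult_left_mono gauss_second_order_bound c) auto
      finally show "\<bar>F y * gauss c y z - F y * gauss c y x - V y \<bullet> (z - x)\<bar> \<le> \<dots>" .
    qed (use F V int in auto)
    then show ?thesis by (simp add: M_def mult_ac)
  qed
  have "(I has_derivative L) (at x)"
    unfolding has_derivative_iff_norm
  proof
    show "bounded_linear L" unfolding L_def by (rule bounded_linear_inner_right)
    have "((\<lambda>z. M * norm (z - x)) \<longlongrightarrow> M * norm (x - x)) (at x)"
      by (intro tendsto_intros)
    then have lim: "((\<lambda>z. M * norm (z - x)) \<longlongrightarrow> 0) (at x)" by simp
    have le: "norm (norm (I z - I x - L (z - x)) / norm (z - x)) \<le> M * norm (z - x)" for z
    proof (cases "z = x")
      case False
      then show ?thesis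
        using bound[of z] by (simp add: pos_divide_le_eq power2_eq_square mult.assoc)
    qed simp
    show "((\<lambda>z. norm (I z - I x - L (z - x)) / norm (z - x)) \<longlongrightarrow> 0) (at x)"
      by (rule Lim_null_comparison[OF always_eventually[OF allI[OF le]] lim])
  qed
  then show ?thesis unfolding I_def[symmetric] differentiable_def by blast
qed

lemma heat_regular_differentiable:
  fixes F :: "real^'n::finite \<Rightarrow> real"
  assumes F: "integrable lborel F" and t: "t > 0"
  shows "heat t (regular F) differentiable (at x)"
proof -
  let ?K = "(4 * pi * t) powr (- real CARD('n) / 2)" and ?c = "1 / (4 * t)"
  have "heat t (regular F) = (\<lambda>x. ?K * (\<integral>y. F y * gauss ?c y x \<partial>lborel))"
  proof
    fix x :: "real^'n"
    have "heat t (regular F) x = (\<integral>y. F y * heat_kernel t (x - y) \<partial>lborel)"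
      using heat_kernel_schwartz[OF t, of x] by (simp add: heat_def regular_def)
    \<comment> \<open>By symmetry the centre passes from \<open>x\<close> to \<open>y\<close>, which
      leaves a function of \<open>x\<close> to differentiate.\<close>
    also have "\<dots> = (\<integral>y. ?K * (F y * gauss ?c y x) \<partial>lborel)"
      by (simp add: heat_kernel_eq_gauss gauss_def norm_minus_commute mult_ac)
    finally show "heat t (regular F) x = ?K * (\<integral>y. F y * gauss ?c y x \<partial>lborel)"
      by simp
  qed
  then show ?thesis
    using gauss_integral_differentiable[OF F, of ?c x] t by simp
qed

section \<open>Parabolic rescaling of solutions\<close>

text \<open>All that \<open>heat\<close> needs from a functional to commute with scaling. Unlike membership in
  \<open>tempered\<close>, it holds for every \<open>regular f\<close> without integrability conditions on \<open>f\<close>.\<close>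

definition respects_cmult :: "'n::finite functional \<Rightarrow> bool" where
  "respects_cmult v \<longleftrightarrow> (\<forall>\<phi>\<in>schwartz. \<forall>c. v (\<lambda>x. c * \<phi> x) = c * v \<phi>)"

lemma respects_cmult_tempered:
  assumes "v \<in> tempered"
  shows "respects_cmult v"
  unfolding respects_cmult_def
proof (intro ballI allI)
  fix \<phi> :: "real^'a \<Rightarrow> real" and c :: real assume \<phi>: "\<phi> \<in> schwartz"
  have lin: "v (\<lambda>x. c * \<phi> x + \<psi> x) = c * v \<phi> + v \<psi>" if "\<psi> \<in> schwartz" "\<phi> \<in> schwartz" for c \<phi> \<psi>
    using assms that by (auto simp: tempered_def)
  \<comment> \<open>Linearity is stated for \<open>c * \<phi> + \<psi>\<close> only. Taking
    \<open>\<psi> = 0\<close> requires that the zero function be Schwartz and that \<open>v\<close>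
    vanish on it.\<close>
  have "(\<lambda>x. 0 * gauss 1 0 x) \<in> schwartz"
    by (intro tanh_gauss_schwartz tanh_algebra.intros) auto
  then have 0: "(\<lambda>x. 0) \<in> schwartz" by simp
  from lin[OF 0 0, of 1] have "v (\<lambda>x. 0) = 0" by simp
  with lin[OF 0 \<phi>, of c] show "v (\<lambda>x. c * \<phi> x) = c * v \<phi>" by simp
qed

lemma schwartz_cmult:
  assumes "\<phi> \<in> schwartz"
  shows "(\<lambda>x. c * \<phi> x) \<in> schwartz"
proof -
  have d: "iter_partial is \<phi> differentiable at x" for "is" x
    using assms by (auto simp: schwartz_def)
  have eq: "iter_partial is (\<lambda>x. c * \<phi> x) = (\<lambda>x. c * iter_partial is \<phi> x)" for "is"
  proof (induction "is")
    case (Cons i "is")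
    have "((\<lambda>x. c * iter_partial is \<phi> x) has_derivative
        (\<lambda>h. c * frechet_derivative (iter_partial is \<phi>) (at x) h)) (at x)" for x
      using d by (intro has_derivative_mult_right) (simp add: frechet_derivative_works[symmetric])
    from frechet_derivative_at[OF this, symmetric] show ?case
      by (simp add: Cons.IH)
  qed simp
  show ?thesis
    unfolding schwartz_def
  proof (intro CollectI allI conjI)
    fix "is" x k
    show "iter_partial is (\<lambda>x. c * \<phi> x) differentiable at x"
      unfolding eq using d by auto
    have "bounded (range (\<lambda>x. (1 + norm x) ^ k * iter_partial is \<phi> x))"
      using assms by (auto simp: schwartz_def)
    then have "bounded ((\<lambda>z. c *\<^sub>R z) ` range (\<lambda>x. (1 + norm x) ^ k * iter_partial is \<phi> x))"
      by (rule bounded_scaling)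
    then show "bounded (range (\<lambda>x. (1 + norm x) ^ k * iter_partial is (\<lambda>x. c * \<phi> x) x))"
      by (simp add: eq image_image mult_ac)
  qed
qed

text \<open>If the product with \<open>\<phi>\<close> is not integrable, its integral is 0 by
  default; so is that of every multiple, by default for \<open>c \<noteq> 0\<close> and because the
  integrand vanishes for \<open>c = 0\<close>.\<close>

lemma respects_cmult_regular: "respects_cmult (regular f)"
  unfolding respects_cmult_def regular_def
  by (auto simp: schwartz_cmult mult.left_commute[of "f _"])

text \<open>Scaling is moved from the functional onto the kernel. The factor \<open>r ^ n\<close>
  from \<open>heat_kernel_scale\<close> cancels the Jacobian in \<open>dilate\<close>.\<close>

lemma heat_rescale:
  fixes v :: "'n::finite functional"
  assumes "respects_cmult v" "r > 0" "t > 0"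
  shows "heat t (rescale k r v) x = r powr k * heat (r\<^sup>2 * t) v (r *\<^sub>R x)"
proof -
  have "heat_kernel t (x - y /\<^sub>R r) = r ^ CARD('n) * heat_kernel (r\<^sup>2 * t) (r *\<^sub>R x - y)" for y :: "real^'n"
    using heat_kernel_scale[of r t "r *\<^sub>R x - y"] assms by (simp add: scaleR_diff_right)
  moreover have "v (\<lambda>y. r ^ CARD('n) * heat_kernel (r\<^sup>2 * t) (r *\<^sub>R x - y))
      = r ^ CARD('n) * v (\<lambda>y. heat_kernel (r\<^sup>2 * t) (r *\<^sub>R x - y))"
    using assms heat_kernel_schwartz[of "r\<^sup>2 * t" "r *\<^sub>R x"] by (auto simp: respects_cmult_def)
  ultimately show ?thesis
    using assms by (simp add: heat_def rescale_def dilate_def)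
qed

section \<open>Invariance of the Besov norm and of continuity\<close>

lemma SUP_parabolic_rescale:
  fixes f :: "real \<Rightarrow> ennreal"
  assumes "r > 0"
  shows "(SUP t\<in>{0<..}. f (r\<^sup>2 * t)) = (SUP t\<in>{0<..}. f t)"
proof -
  have "(\<lambda>t. r\<^sup>2 * t) ` {0<..} = {0<..}"
  proof (intro equalityI subsetI)
    fix t :: real assume "t \<in> {0<..}"
    then show "t \<in> (\<lambda>t. r\<^sup>2 * t) ` {0<..}"
      using assms by (intro image_eqI[of _ _ "t / r\<^sup>2"]) auto
  qed (use assms in auto)
  then show ?thesis by (metis image_image)
qed

text \<open>The norm of \<open>L^1\<close> takes \<open>r powr n\<close> away from the amplitude.
  The remaining \<open>r powr \<beta>\<close> is what the weight gains between the times
  \<open>s\<close> and \<open>r\<^sup>2 * s\<close>.\<close>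

lemma besov_norm_rescale:
  fixes v :: "'n::finite functional"
  assumes v: "respects_cmult v" and r: "r > 0"
  shows "besov_norm \<beta> (rescale (real CARD('n) + \<beta>) r v) = besov_norm \<beta> v"
proof -
  have "ennreal (s powr (\<beta> / 2)) * Lp_norm 1 (heat s (rescale (real CARD('n) + \<beta>) r v))
      = ennreal ((r\<^sup>2 * s) powr (\<beta> / 2)) * Lp_norm 1 (heat (r\<^sup>2 * s) v)" if s: "s > 0" for s
  proof -
    have "heat s (rescale (real CARD('n) + \<beta>) r v)
        = (\<lambda>x. r powr (real CARD('n) + \<beta>) * heat (r\<^sup>2 * s) v (r *\<^sub>R x))"
      using heat_rescale[OF v r s] by auto
    then have L: "Lp_norm 1 (heat s (rescale (real CARD('n) + \<beta>) r v))
        = ennreal (r powr (real CARD('n) + \<beta>) * r powr (- real CARD('n) / 1)) * Lp_norm 1 (heat (r\<^sup>2 * s) v)"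
      using r by (simp only:) (rule Lp_norm_scale, auto)
    have e: "r powr (real CARD('n) + \<beta>) * r powr (- real CARD('n) / 1) = r powr \<beta>"
      by (simp add: powr_add[symmetric])
    have "(r\<^sup>2 * s) powr (\<beta> / 2) = s powr (\<beta> / 2) * r powr \<beta>"
      using r s by (simp add: powr_mult powr_powr mult.commute flip: powr_numeral)
    then show ?thesis
      unfolding L e by (simp add: ennreal_mult mult.assoc)
  qed
  then have "besov_norm \<beta> (rescale (real CARD('n) + \<beta>) r v)
      = (SUP s\<in>{0<..}. ennreal ((r\<^sup>2 * s) powr (\<beta> / 2)) * Lp_norm 1 (heat (r\<^sup>2 * s) v))"
    unfolding besov_norm_def by (intro SUP_cong) auto
  also have "\<dots> = besov_norm \<beta> v"
    unfolding besov_norm_def by (rule SUP_parabolic_rescale[OF r])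
  finally show ?thesis .
qed

lemma besov_rescale:
  fixes v :: "'n::finite functional"
  assumes "v \<in> besov \<beta>" "r > 0"
  shows "rescale (real CARD('n) + \<beta>) r v \<in> besov \<beta>"
  using assms by (simp add: besov_def tempered_rescale besov_norm_rescale respects_cmult_tempered)

text \<open>In the norm topology, the increment of the rescaled path is the rescaled increment and
  has the same Besov norm. In the other one, the scaling is moved onto the test function.\<close>

lemma continuous_path_rescale:
  fixes u :: "real \<Rightarrow> 'n::finite functional"
  assumes cont: "continuous_path T \<beta> u" and temp: "\<And>t. t \<ge> 0 \<Longrightarrow> u t \<in> tempered" and r: "r > 0"
  shows "continuous_path T \<beta> (\<lambda>t. rescale (real CARD('n) + \<beta>) r (u (r\<^sup>2 * t)))"
proof (cases T)
  case Norm_Topology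
  have "((\<lambda>s. besov_norm \<beta> (rescale (real CARD('n) + \<beta>) r (u (r\<^sup>2 * s))
      - rescale (real CARD('n) + \<beta>) r (u (r\<^sup>2 * t)))) \<longlongrightarrow> 0) (at t within {0..})" if t: "t \<ge> 0" for t
  proof -
    have lim: "((\<lambda>s. besov_norm \<beta> (u s - u (r\<^sup>2 * t))) \<longlongrightarrow> 0) (at (r\<^sup>2 * t) within {0..})"
      using cont t Norm_Topology by simp
    \<comment> \<open>The filters are punctured, so this also uses that \<open>r\<^sup>2 * s\<close>
      differs from \<open>r\<^sup>2 * t\<close> whenever \<open>s\<close> differs from
      \<open>t\<close>.\<close>
    have "filterlim (\<lambda>s. r\<^sup>2 * s) (at (r\<^sup>2 * t) within {0..}) (at t within {0..})"
      using r unfolding filterlim_at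
      by (auto simp: eventually_at_filter intro!: tendsto_intros)
    from filterlim_compose[OF lim this]
    have "((\<lambda>s. besov_norm \<beta> (u (r\<^sup>2 * s) - u (r\<^sup>2 * t))) \<longlongrightarrow> 0) (at t within {0..})" .
    moreover have "\<forall>\<^sub>F s in at t within {0..}. besov_norm \<beta> (u (r\<^sup>2 * s) - u (r\<^sup>2 * t)) =
        besov_norm \<beta> (rescale (real CARD('n) + \<beta>) r (u (r\<^sup>2 * s)) - rescale (real CARD('n) + \<beta>) r (u (r\<^sup>2 * t)))"
    proof -
      have "besov_norm \<beta> (u (r\<^sup>2 * s) - u (r\<^sup>2 * t)) =
        besov_norm \<beta> (rescale (real CARD('n) + \<beta>) r (u (r\<^sup>2 * s)) - rescale (real CARD('n) + \<beta>) r (u (r\<^sup>2 * t)))"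
        if s: "s \<ge> 0" for s
      proof -
        have "rescale (real CARD('n) + \<beta>) r (u (r\<^sup>2 * s)) - rescale (real CARD('n) + \<beta>) r (u (r\<^sup>2 * t))
            = rescale (real CARD('n) + \<beta>) r (u (r\<^sup>2 * s) - u (r\<^sup>2 * t))"
          by (auto simp: rescale_def dilate_def fun_eq_iff diff_divide_distrib right_diff_distrib)
        moreover have "respects_cmult (u (r\<^sup>2 * s) - u (r\<^sup>2 * t))"
          using respects_cmult_tempered[OF temp, of "r\<^sup>2 * s"] respects_cmult_tempered[OF temp, of "r\<^sup>2 * t"] s t
          by (auto simp: respects_cmult_def right_diff_distrib)
        ultimately show ?thesis using besov_norm_rescale r by metis
      qed
      then show ?thesis by (auto simp: eventually_at_filter)
    qed
    ultimately show ?thesis by (rule Lim_transform_eventually)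
  qed
  then show ?thesis using Norm_Topology by simp
next
  case Distribution_Topology
  have "continuous_on {0..} (\<lambda>t. rescale (real CARD('n) + \<beta>) r (u (r\<^sup>2 * t)) \<phi>)" if \<phi>: "\<phi> \<in> schwartz" for \<phi>
  proof -
    have "(\<lambda>x. \<phi> (x /\<^sub>R r)) \<in> schwartz"
      using schwartz_scale[OF \<phi>, of "inverse r"] r by simp
    then have "continuous_on {0..} (\<lambda>t. u t (\<lambda>x. \<phi> (x /\<^sub>R r)))"
      using cont Distribution_Topology by simp
    then have "continuous_on {0..} (\<lambda>t. u (r\<^sup>2 * t) (\<lambda>x. \<phi> (x /\<^sub>R r)))"
      by (rule continuous_on_compose2) (auto intro!: continuous_intros)
    then show ?thesis
      unfolding rescale_def dilate_def using r by (auto intro!: continuous_intros)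
  qed
  then show ?thesis using Distribution_Topology by simp
qed

section \<open>Representatives and the decay norm\<close>

lemma rescale_regular:
  fixes f :: "real^'n::finite \<Rightarrow> real"
  assumes r: "r > 0"
  shows "rescale k r (regular f) = regular (\<lambda>x. r powr k * f (r *\<^sub>R x))"
proof
  fix \<phi> :: "real^'n \<Rightarrow> real"
  show "rescale k r (regular f) \<phi> = regular (\<lambda>x. r powr k * f (r *\<^sub>R x)) \<phi>"
  proof (cases "\<phi> \<in> schwartz")
    case True
    then have "(\<lambda>x. \<phi> (x /\<^sub>R r)) \<in> schwartz"
      using schwartz_scale[of \<phi> "inverse r"] r by simp
    with True show ?thesis
      using r integral_lborel_scaleR[OF r, of "\<lambda>x. f x * \<phi> (x /\<^sub>R r)"]
      by (simp add: rescale_def dilate_def regular_def mult.assoc)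
  next
    case False
    then have "(\<lambda>x. \<phi> (x /\<^sub>R r)) \<notin> schwartz"
      using schwartz_scale_iff[of "inverse r" \<phi>] r by simp
    with False show ?thesis by (simp add: rescale_def dilate_def regular_def)
  qed
qed

lemma Lp_space_scale:
  fixes f :: "real^'n::finite \<Rightarrow> real"
  assumes "f \<in> Lp_space p" "r > 0" "c > 0" "p > 0"
  shows "(\<lambda>x. c * f (r *\<^sub>R x)) \<in> Lp_space p"
proof -
  have [measurable]: "f \<in> borel_measurable borel" using assms(1) by (rule Lp_space_measurable)
  show ?thesis
    using assms by (auto simp: Lp_space_def Lp_norm_scale ennreal_mult_less_top)
qed

lemma Lp_rep:
  assumes "v \<in> Lp_distr p"
  shows "Lp_rep p v \<in> Lp_space p" "regular (Lp_rep p v) = v"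
proof -
  have "\<exists>f. f \<in> Lp_space p \<and> v = regular f" using assms by (auto simp: Lp_distr_def)
  from someI_ex[OF this] show "Lp_rep p v \<in> Lp_space p" "regular (Lp_rep p v) = v"
    by (auto simp: Lp_rep_def)
qed

lemma Lp_distr_rescale:
  assumes "v \<in> Lp_distr p" "r > 0" "p > 0"
  shows "rescale k r v \<in> Lp_distr p"
proof -
  obtain f where "f \<in> Lp_space p" "v = regular f" using assms by (auto simp: Lp_distr_def)
  then show ?thesis
    using assms Lp_space_scale[of f p r "r powr k"] by (auto simp: Lp_distr_def rescale_regular)
qed

lemma Lp_rep_rescale:
  assumes "v \<in> Lp_distr p" "r > 0" "p \<ge> 1"
  shows "AE x in lborel. Lp_rep p (rescale k r v) x = r powr k * Lp_rep p v (r *\<^sub>R x)"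
proof (rule regular_inject_AE)
  show "Lp_rep p (rescale k r v) \<in> Lp_space p"
    using assms by (intro Lp_rep Lp_distr_rescale) auto
  show "(\<lambda>x. r powr k * Lp_rep p v (r *\<^sub>R x)) \<in> Lp_space p"
    using assms by (intro Lp_space_scale Lp_rep) auto
  show "regular (Lp_rep p (rescale k r v)) = regular (\<lambda>x. r powr k * Lp_rep p v (r *\<^sub>R x))"
    using assms by (simp add: Lp_rep Lp_distr_rescale rescale_regular[symmetric])
qed fact

lemma Lp_norm_cong_AE:
  assumes "AE x in lborel. f x = g x"
  shows "Lp_norm p f = Lp_norm p g"
proof -
  have "(\<integral>\<^sup>+x. ennreal (\<bar>f x\<bar> powr p) \<partial>lborel) = (\<integral>\<^sup>+x. ennreal (\<bar>g x\<bar> powr p) \<partial>lborel)"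
    using assms by (intro nn_integral_cong_AE) auto
  then show ?thesis by (simp add: Lp_norm_def)
qed

text \<open>The norm of \<open>L^q\<close> produces the power \<open>n + \<beta> - n / q\<close> of
  \<open>r\<close>, which is twice the decay exponent \<open>e\<close>.\<close>

lemma decay_norm_rescale:
  fixes u :: "real \<Rightarrow> 'n::finite functional"
  assumes u: "\<And>t. t > 0 \<Longrightarrow> u t \<in> Lp_distr q" and r: "r > 0" and q: "q \<ge> 1"
  shows "decay_norm \<beta> q (\<lambda>t. rescale (real CARD('n) + \<beta>) r (u (r\<^sup>2 * t))) = decay_norm \<beta> q u"
proof -
  define e where "e = real CARD('n) / 2 * (1 - 1 / q) + \<beta> / 2"
  let ?w = "\<lambda>t. rescale (real CARD('n) + \<beta>) r (u (r\<^sup>2 * t))"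
  have "ennreal (t powr e) * Lp_norm q (Lp_rep q (?w t))
      = ennreal ((r\<^sup>2 * t) powr e) * Lp_norm q (Lp_rep q (u (r\<^sup>2 * t)))" if t: "t > 0" for t
  proof -
    have "Lp_norm q (Lp_rep q (?w t))
        = Lp_norm q (\<lambda>x. r powr (real CARD('n) + \<beta>) * Lp_rep q (u (r\<^sup>2 * t)) (r *\<^sub>R x))"
      using u r q t by (intro Lp_norm_cong_AE Lp_rep_rescale) auto
    also have "\<dots> = ennreal (r powr (real CARD('n) + \<beta>) * r powr (- real CARD('n) / q))
        * Lp_norm q (Lp_rep q (u (r\<^sup>2 * t)))"
      using r q by (intro Lp_norm_scale) auto
    also have "r powr (real CARD('n) + \<beta>) * r powr (- real CARD('n) / q) = r powr (2 * e)"
      unfolding powr_add[symmetric] e_def using q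
      by (intro arg_cong[where f="\<lambda>e. r powr e"]) (simp add: field_simps)
    finally have 1: "Lp_norm q (Lp_rep q (?w t)) = ennreal (r powr (2 * e)) * Lp_norm q (Lp_rep q (u (r\<^sup>2 * t)))" .
    have "(r\<^sup>2 * t) powr e = t powr e * r powr (2 * e)"
      using r t by (simp add: powr_mult powr_powr mult.commute flip: powr_numeral)
    with 1 show ?thesis by (simp add: ennreal_mult mult.assoc)
  qed
  then have "decay_norm \<beta> q ?w
      = (SUP t\<in>{0<..}. ennreal ((r\<^sup>2 * t) powr e) * Lp_norm q (Lp_rep q (u (r\<^sup>2 * t))))"
    unfolding decay_norm_def e_def[symmetric] by (intro SUP_cong) auto
  also have "\<dots> = decay_norm \<beta> q u"
    unfolding decay_norm_def e_def[symmetric] by (rule SUP_parabolic_rescale[OF r])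
  finally show ?thesis .
qed

section \<open>The nonlinear term and the Duhamel integral\<close>

lemma flux_measurable:
  assumes "v \<in> Lp_distr q"
  shows "flux q v \<in> borel_measurable borel"
proof -
  have [measurable]: "Lp_rep q v \<in> borel_measurable borel"
    using Lp_rep(1)[OF assms] by (rule Lp_space_measurable)
  show ?thesis unfolding flux_def[abs_def] by measurable
qed

text \<open>The flux has absolute value \<open>\<bar>u\<bar> powr q\<close>, so membership in
  \<open>L^q\<close> is exactly its integrability.\<close>

lemma flux_integrable:
  assumes "v \<in> Lp_distr q"
  shows "integrable lborel (flux q v)"
proof (rule Bochner_Integration.integrable_bound[OF Lp_space_integrable_powr[OF Lp_rep(1)[OF assms]]])
  show "flux q v \<in> borel_measurable lborel" using flux_measurable[OF assms] by simp
  have "\<bar>flux q v x\<bar> = \<bar>Lp_rep q v x\<bar> powr q" for x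
    using powr_mult_base[of "\<bar>Lp_rep q v x\<bar>" "q - 1"] by (simp add: flux_def abs_mult)
  then show "AE x in lborel. norm (flux q v x) \<le> norm (\<bar>Lp_rep q v x\<bar> powr q)" by simp
qed

lemma schwartz_measurable:
  assumes "\<phi> \<in> schwartz"
  shows "\<phi> \<in> borel_measurable borel"
proof -
  have "iter_partial [] \<phi> differentiable at x" for x
    using assms unfolding schwartz_def by blast
  then have "continuous_on UNIV \<phi>"
    by (auto intro!: differentiable_imp_continuous_on simp: differentiable_on_def)
  then show ?thesis by (rule borel_measurable_continuous_onI)
qed

lemma regular_cong_AE:
  assumes [measurable]: "f \<in> borel_measurable borel" "g \<in> borel_measurable borel"
    and "AE x in lborel. f x = g x"
  shows "regular f = regular g"
proof
  fix \<phi>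
  show "regular f \<phi> = regular g \<phi>"
  proof (cases "\<phi> \<in> schwartz")
    case True
    then have [measurable]: "\<phi> \<in> borel_measurable borel" by (rule schwartz_measurable)
    have "(\<integral>x. f x * \<phi> x \<partial>lborel) = (\<integral>x. g x * \<phi> x \<partial>lborel)"
      using assms(3) by (intro integral_cong_AE) auto
    then show ?thesis by (simp add: regular_def)
  qed (simp add: regular_def)
qed

text \<open>Representatives agree only off a null set, but \<open>regular\<close> does not see null
  sets. The identity is thus exact, and after \<open>heat\<close> everything holds at every
  point.\<close>

lemma regular_flux_rescale:
  fixes v :: "'n::finite functional"
  assumes v: "v \<in> Lp_distr q" and r: "r > 0" and q: "q \<ge> 1"
  shows "regular (flux q (rescale k r v)) = rescale (k * q) r (regular (flux q v))"
  unfolding rescale_regular[OF r]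
proof (rule regular_cong_AE)
  show "flux q (rescale k r v) \<in> borel_measurable borel"
    using assms by (intro flux_measurable Lp_distr_rescale) auto
  show "(\<lambda>x. r powr (k * q) * flux q v (r *\<^sub>R x)) \<in> borel_measurable borel"
    using flux_measurable[OF v] by auto
  show "AE x in lborel. flux q (rescale k r v) x = r powr (k * q) * flux q v (r *\<^sub>R x)"
    using Lp_rep_rescale[OF v r q, of k]
  proof eventually_elim
    case (elim x)
    have "r powr k * (r powr k) powr (q - 1) = r powr (k * q)"
      using r by (simp add: powr_powr powr_add[symmetric] algebra_simps)
    then show ?case
      using elim r by (simp add: flux_def abs_mult powr_mult mult_ac)
  qed
qed

text \<open>The flux gives \<open>k * q\<close>, and the chain rule one further factor
  \<open>r\<close>. The chain rule is legitimate because the flux is integrable and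
  \<open>t - \<tau> > 0\<close>.\<close>

lemma duhamel_rescale:
  fixes u :: "real \<Rightarrow> 'n::finite functional"
  assumes u: "u (r\<^sup>2 * \<tau>) \<in> Lp_distr q" and r: "r > 0" and q: "q \<ge> 1" and \<tau>: "\<tau> < t"
  shows "duhamel a q (\<lambda>t. rescale k r (u (r\<^sup>2 * t))) t x \<tau>
       = r powr (k * q + 1) * duhamel a q u (r\<^sup>2 * t) (r *\<^sub>R x) (r\<^sup>2 * \<tau>)"
proof -
  let ?V = "regular (flux q (u (r\<^sup>2 * \<tau>)))"
  let ?s = "r\<^sup>2 * t - r\<^sup>2 * \<tau>"
  have s: "?s > 0" using r \<tau> by simp
  have d: "heat ?s ?V differentiable (at (r *\<^sub>R x))"
    using s u by (intro heat_regular_differentiable flux_integrable)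
  have "heat (t - \<tau>) (regular (flux q (rescale k r (u (r\<^sup>2 * \<tau>)))))
      = (\<lambda>x. r powr (k * q) * heat ?s ?V (r *\<^sub>R x))"
    using r \<tau> by (simp add: regular_flux_rescale[OF u r q] heat_rescale[OF respects_cmult_regular]
        fun_eq_iff right_diff_distrib)
  moreover have "((\<lambda>x. r powr (k * q) * heat ?s ?V (r *\<^sub>R x)) has_derivative
      (\<lambda>h. r powr (k * q) * frechet_derivative (heat ?s ?V) (at (r *\<^sub>R x)) (r *\<^sub>R h))) (at x)"
  proof (rule has_derivative_mult_right)
    have "((\<lambda>x. r *\<^sub>R x) has_derivative (\<lambda>h. r *\<^sub>R h)) (at x)"
      by (auto intro!: derivative_eq_intros)
    moreover have "(heat ?s ?V has_derivative frechet_derivative (heat ?s ?V) (at (r *\<^sub>R x))) (at (r *\<^sub>R x))"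
      using d by (simp add: frechet_derivative_works[symmetric])
    ultimately show "((\<lambda>x. heat ?s ?V (r *\<^sub>R x)) has_derivative
        (\<lambda>h. frechet_derivative (heat ?s ?V) (at (r *\<^sub>R x)) (r *\<^sub>R h))) (at x)"
      by (rule has_derivative_compose)
  qed
  ultimately have "duhamel a q (\<lambda>t. rescale k r (u (r\<^sup>2 * t))) t x \<tau>
      = r powr (k * q) * frechet_derivative (heat ?s ?V) (at (r *\<^sub>R x)) (r *\<^sub>R a)"
    unfolding duhamel_def by (simp add: frechet_derivative_at[symmetric])
  also have "\<dots> = r powr (k * q) * (r * frechet_derivative (heat ?s ?V) (at (r *\<^sub>R x)) a)"
    by (simp add: linear_cmul[OF linear_frechet_derivative[OF d]])
  finally show ?thesis
    using r by (simp add: duhamel_def powr_add)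
qed

lemma rescale_homogeneous:
  assumes "homogeneous (- k) v" "r > 0"
  shows "rescale k r v = v"
proof -
  have "r powr k * r powr (- k) = 1" using assms by (simp add: powr_add[symmetric])
  then show ?thesis
    using assms by (simp add: homogeneous_def rescale_def mult.assoc[symmetric])
qed

text \<open>The integrand scales by \<open>r powr (k * q + 1) = r powr (k + 2)\<close>. Substituting
  \<open>\<sigma> = r\<^sup>2 * \<tau>\<close> takes two powers back, so all terms carry the common
  factor \<open>r powr k\<close>.\<close>

lemma mild_solution_rescale:
  fixes u :: "real \<Rightarrow> 'n::finite functional"
  assumes sol: "mild_solution a q u0 u" and u: "\<And>t. t > 0 \<Longrightarrow> u t \<in> Lp_distr q"
    and u0: "u0 \<in> tempered" "homogeneous (- k) u0"
    and r: "r > 0" and q: "q \<ge> 1" and kq: "k * q = k + 1"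
  shows "mild_solution a q u0 (\<lambda>t. rescale k r (u (r\<^sup>2 * t)))"
  unfolding mild_solution_def
proof (intro conjI allI impI)
  show "rescale k r (u (r\<^sup>2 * 0)) = u0"
    using sol rescale_homogeneous[OF u0(2) r] by (simp add: mild_solution_def)
  fix t :: real assume t: "t > 0"
  define w where "w = (\<lambda>t. rescale k r (u (r\<^sup>2 * t)))"
  have r2t: "r\<^sup>2 * t > 0" using r t by simp
  let ?P = "\<lambda>y. set_integrable lborel {0<..<r\<^sup>2 * t} (duhamel a q u (r\<^sup>2 * t) y) \<and>
      Lp_rep q (u (r\<^sup>2 * t)) y = heat (r\<^sup>2 * t) u0 y
        - (LINT \<tau>:{0<..<r\<^sup>2 * t}|lborel. duhamel a q u (r\<^sup>2 * t) y \<tau>)"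
  have "AE y in lborel. ?P y"
    using sol r2t by (auto simp: mild_solution_def)
  then have P: "AE x in lborel. ?P (r *\<^sub>R x)"
    using r by (rule AE_lborel_scaleR)
  have R: "AE x in lborel. Lp_rep q (w t) x = r powr k * Lp_rep q (u (r\<^sup>2 * t)) (r *\<^sub>R x)"
    unfolding w_def using u r2t r q by (intro Lp_rep_rescale) auto
  from P R show "AE x in lborel. set_integrable lborel {0<..<t} (duhamel a q w t x) \<and>
      Lp_rep q (w t) x = heat t u0 x - (LINT \<tau>:{0<..<t}|lborel. duhamel a q w t x \<tau>)"
  proof eventually_elim
    case (elim x)
    \<comment> \<open>With the indicator built in, one affine substitution on the whole line handles
      both integrability and the value; the form \<open>0 + r\<^sup>2 * \<tau>\<close> below is the
      one of the affine lemmas.\<close>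
    define g where "g \<sigma> = indicator {0<..<r\<^sup>2 * t} \<sigma> *\<^sub>R duhamel a q u (r\<^sup>2 * t) (r *\<^sub>R x) \<sigma>" for \<sigma>
    have g: "indicator {0<..<t} \<tau> *\<^sub>R duhamel a q w t x \<tau> = r powr (k + 2) * g (0 + r\<^sup>2 * \<tau>)" for \<tau>
    proof (cases "\<tau> \<in> {0<..<t}")
      case True
      then have "duhamel a q w t x \<tau> = r powr (k * q + 1) * duhamel a q u (r\<^sup>2 * t) (r *\<^sub>R x) (r\<^sup>2 * \<tau>)"
        unfolding w_def using u r q by (intro duhamel_rescale) auto
      with True show ?thesis using r by (simp add: g_def kq add.commute)
    next
      case False
      then have "r\<^sup>2 * \<tau> \<notin> {0<..<r\<^sup>2 * t}" using r by (auto simp: zero_less_mult_iff)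
      with False show ?thesis by (simp add: g_def)
    qed
    have gi: "integrable lborel g" using elim by (simp add: set_integrable_def g_def[abs_def])
    have "integrable lborel (\<lambda>\<tau>. r powr (k + 2) * g (0 + r\<^sup>2 * \<tau>))"
      using r by (intro integrable_mult_right lborel_integrable_real_affine gi) auto
    then have "set_integrable lborel {0<..<t} (duhamel a q w t x)"
      by (simp only: set_integrable_def g)
    moreover have "(LINT \<tau>:{0<..<t}|lborel. duhamel a q w t x \<tau>)
        = r powr k * (LINT \<sigma>:{0<..<r\<^sup>2 * t}|lborel. duhamel a q u (r\<^sup>2 * t) (r *\<^sub>R x) \<sigma>)"
    proof -
      have "(LINT \<tau>:{0<..<t}|lborel. duhamel a q w t x \<tau>) = r powr (k + 2) * (\<integral>\<tau>. g (0 + r\<^sup>2 * \<tau>) \<partial>lborel)"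
        by (simp only: set_lebesgue_integral_def g integral_mult_right_zero)
      also have "\<dots> = r powr k * (r\<^sup>2 * (\<integral>\<tau>. g (0 + r\<^sup>2 * \<tau>) \<partial>lborel))"
        using r by (simp add: powr_add)
      also have "r\<^sup>2 * (\<integral>\<tau>. g (0 + r\<^sup>2 * \<tau>) \<partial>lborel) = (\<integral>\<sigma>. g \<sigma> \<partial>lborel)"
        using r lborel_integral_real_affine[of "r\<^sup>2" g 0] by simp
      finally show ?thesis by (simp add: g_def set_lebesgue_integral_def)
    qed
    moreover have "heat t u0 x = r powr k * heat (r\<^sup>2 * t) u0 (r *\<^sub>R x)"
      using heat_rescale[OF respects_cmult_tempered[OF u0(1)] r t, of k x]
      by (simp add: rescale_homogeneous[OF u0(2) r])
    ultimately show ?case using elim by (simp add: right_diff_distrib)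
  qed
qed

theorem theorem5p1:
  fixes a :: "real^'n::finite"
    and \<beta> q \<epsilon> :: real
    and T :: besov_topology
    and u0 :: "'n functional"
    and u :: "real \<Rightarrow> 'n functional"
  assumes "0 < \<beta>" "\<beta> < 1"
    and "q = 1 + 1 / (real CARD('n) + \<beta>)"
    and "0 < \<epsilon>"
    and existence: "\<forall>w0\<in>besov \<beta>. besov_norm \<beta> w0 < ennreal \<epsilon> \<longrightarrow>
      (\<exists>w\<in>X_space T \<beta> q. mild_solution a q w0 w \<and> decay_norm \<beta> q w \<le> ennreal (2 * \<epsilon>) \<and>
        (\<forall>w'\<in>X_space T \<beta> q. mild_solution a q w0 w' \<and> decay_norm \<beta> q w' \<le> ennreal (2 * \<epsilon>)
           \<longrightarrow> (\<forall>t\<ge>0. w' t = w t)))"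
    and "u0 \<in> besov \<beta>" "besov_norm \<beta> u0 < ennreal \<epsilon>"
    and "homogeneous (- real CARD('n) - \<beta>) u0"
    and "u \<in> X_space T \<beta> q" "mild_solution a q u0 u" "decay_norm \<beta> q u \<le> ennreal (2 * \<epsilon>)"
  shows "self_similar (real CARD('n) + \<beta>) u \<and>
    (\<forall>t>0. AE x in lborel. Lp_rep q (u t) x =
       t powr (- (real CARD('n) + \<beta>) / 2) * Lp_rep q (u 1) (x /\<^sub>R sqrt t))"
proof -
  define k where "k = real CARD('n) + \<beta>"
  have k: "k > 0" using assms(1) by (simp add: k_def)
  have q: "q \<ge> 1" "k * q = k + 1"
    using k unfolding assms(3) k_def[symmetric] by (auto simp: field_simps)
  have uL: "u t \<in> Lp_distr q" if "t > 0" for t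
    using assms(9) that by (simp add: X_space_def)
  have uB: "u t \<in> besov \<beta>" if "t \<ge> 0" for t
    using assms(9) that by (simp add: X_space_def besov_paths_def)
  have self: "u t = rescale k r (u (r\<^sup>2 * t))" if r: "r > 0" and t: "t > 0" for r t
  proof -
    define w where "w = (\<lambda>t. rescale k r (u (r\<^sup>2 * t)))"
    have decay: "decay_norm \<beta> q w = decay_norm \<beta> q u"
      unfolding w_def k_def using uL r q(1) by (rule decay_norm_rescale)
    have "w \<in> X_space T \<beta> q"
      using assms(9) r uL uB q decay
      unfolding X_space_def besov_paths_def
      by (auto simp: w_def k_def besov_def intro!: continuous_path_rescale Lp_distr_rescale
          besov_rescale[unfolded besov_def, simplified])
    moreover have "mild_solution a q u0 w"
      unfolding w_def using assms(6,8,10) uL r q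
      by (intro mild_solution_rescale) (auto simp: besov_def k_def)
    \<comment> \<open>Uniqueness compares every small solution with the one that exists; both
      \<open>u\<close> and \<open>w\<close> coincide with it.\<close>
    ultimately have "w t = u t"
      using bspec[OF existence assms(6)] assms(7,9,10,11) decay t by (metis less_imp_le)
    then show ?thesis by (simp add: w_def)
  qed
  then have "self_similar (real CARD('n) + \<beta>) u"
    unfolding self_similar_def rescale_def k_def by blast
  moreover have "AE x in lborel. Lp_rep q (u t) x =
       t powr (- (real CARD('n) + \<beta>) / 2) * Lp_rep q (u 1) (x /\<^sub>R sqrt t)" if t: "t > 0" for t
  proof -
    \<comment> \<open>This is the factor with \<open>r\<^sup>2 * t = 1\<close>, which carries time
      \<open>t\<close> to time 1.\<close>
    define r where "r = t powr (- 1 / 2)"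
    have rk: "r powr k = t powr (- k / 2)"
      by (simp add: r_def powr_powr)
    have rs: "r = inverse (sqrt t)"
      using t by (simp add: r_def powr_minus powr_half_sqrt)
    then have r: "r > 0" "r\<^sup>2 * t = 1"
      using t by (auto simp: power_inverse)
    have "u t = rescale k r (u 1)"
      using self[OF r(1) t] by (simp only: r(2))
    then show ?thesis
      using Lp_rep_rescale[OF uL[of 1] r(1) q(1), of k] unfolding rk
      by (simp add: k_def rs)
  qed
  ultimately show ?thesis by blast
qed

end
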